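(* Let $k$ be a field, let $A_1,\dots,A_n$ be non-empty disjoint finite sets, let $A=\bigcup_iA_i$, and let $T\subseteq A_1\times\cdots\times A_n$ be an acyclic subset (equivalently, $J(T)$ is a polarization of an Artin monomial ideal), so that $J(T)\subseteq k[A]$ is a polarization of an Artin monomial ideal $\mathfrak j\subseteq k[x_1,\dots,x_n]$. Let $\Pi(R^k_\bullet)$, $k=1,\dots,m$, be the maximal cells of the cell complex $C(T)$. Let $r^k_i=|R^k_i|$ and let $\mathfrak j_k=(x_1^{r^k_1},x_2^{r^k_2},\dots,x_n^{r^k_n})$, an irreducible monomial ideal. Then: (a) $J(T)=J(R^1_\bullet)\cap J(R^2_\bullet)\cap\cdots\cap J(R^m_\bullet)$. (b) The minimal irreducible decomposition of $\mathfrak j$ is $\mathfrak j=\mathfrak j_1\cap\mathfrak j_2\cap\cdots\cap\mathfrak j_m$. So the components of the minimal irreducible decomposition of $\mathfrak j$ are in bijection with the maximal cells of $C(T)$.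
   Context: $k[A]$ is the polynomial ring with variables the elements of $A$. The rainbow ideal $I(T)\subseteq k[A]$ is generated by the monomials $a_1\cdots a_n$ for $(a_1,\dots,a_n)\in T$. $J(T)$ is the Alexander dual of $I(T)$: the squarefree monomial ideal generated by the monomials having a non-trivial common divisor with every monomial in $I(T)$. For non-empty $R_i\subseteq A_i$, $J(R_\bullet)$ denotes $J(R_1\times\cdots\times R_n)=(m(R_1),\dots,m(R_n))$, where $m(R_i)=\prod_{r\in R_i}r$. For a finite set $V$ let $\Delta(V)\subseteq\mathbb R^V$ be the geometric simplex with vertices $V$. The cell complex $C(T)$ consists of all cells $\Pi(R_\bullet)=\Delta(R_1)\times\cdots\times\Delta(R_n)$ with $\emptyset\ne R_i\subseteq A_i$ and $R_1\times\cdots\times R_n\subseteq T$. The set $T$ is acyclic if for all families of non-empty subsets $R_i\subseteq A_i$, the reduced cellular homology over $k$ of $C(T\cap(R_1\times\cdots\times R_n))$ vanishes in all degrees $i\ge0$. An Artin monomial ideal is one containing a power of each variable. That $J(T)$ is a polarization of $\mathfrak j$ is with respect to the map $A\to\{x_1,\dots,x_n\}$ sending elements of $A_i$ to $x_i$: $J(T)$ is squarefree, its image under $k[A]\to k[x_1,\dots,x_n]$ is $\mathfrak j$, and the differences of variables in the same $A_i$ give a regular sequence for $k[A]/J(T)$ (dividing out by linearly independent such differences spanning the kernel on linear forms). The minimal irreducible decomposition of a monomial ideal is its unique irredundant expression as an intersection of ideals generated by powers of variables. *)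

theory Defs
  imports
    Complex_Main
    "HOL-Algebra.Ideal"
    "HOL-Library.Poly_Mapping"
    "HOL-Library.Countable_Set"
    "HOL-Library.Disjoint_Sets"
begin

section \<open>Polynomial rings and monomial ideals\<close>

type_synonym ('v, 'k) mpoly = "('v \<Rightarrow>\<^sub>0 nat) \<Rightarrow>\<^sub>0 'k"

text \<open>\<open>k[V]\<close> for a set \<open>V\<close> of variables, carried by the polynomials over the whole variable type
  all of whose monomials involve only variables in \<open>V\<close>.\<close>

definition poly_ring :: "'v set \<Rightarrow> ('v, 'k::field) mpoly ring" where
  "poly_ring V =
    \<lparr>carrier = {p. \<forall>u\<in>Poly_Mapping.keys p. Poly_Mapping.keys u \<subseteq> V},
     mult = (*), one = 1, zero = 0, add = (+)\<rparr>"

definition pvar :: "'v \<Rightarrow> ('v, 'k::field) mpoly" where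
  "pvar v = Poly_Mapping.single (Poly_Mapping.single v 1) 1"

definition poly_smult :: "'k::field \<Rightarrow> ('v, 'k) mpoly \<Rightarrow> ('v, 'k) mpoly" where
  "poly_smult c p = Poly_Mapping.single 0 c * p"

interpretation mpoly: vector_space "poly_smult :: 'k::field \<Rightarrow> ('v, 'k) mpoly \<Rightarrow> ('v, 'k) mpoly"
  by unfold_locales
    (simp_all add: poly_smult_def algebra_simps single_add mult_single flip: mult.assoc)

lemma poly_ring_cring: "cring (poly_ring V :: ('v, 'k::field) mpoly ring)"
proof (rule cringI)
  have mult: "\<forall>u\<in>Poly_Mapping.keys (a * b). Poly_Mapping.keys u \<subseteq> V"
    if "\<forall>u\<in>Poly_Mapping.keys a. Poly_Mapping.keys u \<subseteq> V"
      and "\<forall>u\<in>Poly_Mapping.keys b. Poly_Mapping.keys u \<subseteq> V" for a b :: "('v, 'k) mpoly"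
  proof
    fix u assume "u \<in> Poly_Mapping.keys (a * b)"
    then obtain s t where "u = s + t" "s \<in> Poly_Mapping.keys a" "t \<in> Poly_Mapping.keys b"
      using keys_mult[of a b] by blast
    then show "Poly_Mapping.keys u \<subseteq> V" using that Poly_Mapping.keys_add[of s t] by blast
  qed
  show "abelian_group (poly_ring V :: ('v, 'k) mpoly ring)"
  proof (rule abelian_groupI)
    fix x :: "('v, 'k) mpoly" assume "x \<in> carrier (poly_ring V)"
    then show "\<exists>y\<in>carrier (poly_ring V). y \<oplus>\<^bsub>poly_ring V\<^esub> x = \<zero>\<^bsub>poly_ring V\<^esub>"
      by (intro bexI[of _ "- x"]) (auto simp: poly_ring_def)
  next
    fix x y :: "('v, 'k) mpoly"
    assume "x \<in> carrier (poly_ring V)" "y \<in> carrier (poly_ring V)"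
    then show "x \<oplus>\<^bsub>poly_ring V\<^esub> y \<in> carrier (poly_ring V)"
      using Poly_Mapping.keys_add[of x y] unfolding poly_ring_def by auto
  qed (simp_all add: poly_ring_def add_ac)
  show "comm_monoid (poly_ring V :: ('v, 'k) mpoly ring)"
  proof (rule comm_monoidI)
    fix x y :: "('v, 'k) mpoly"
    assume "x \<in> carrier (poly_ring V)" "y \<in> carrier (poly_ring V)"
    then show "x \<otimes>\<^bsub>poly_ring V\<^esub> y \<in> carrier (poly_ring V)"
      using mult[of x y] unfolding poly_ring_def by simp
  qed (simp_all add: poly_ring_def mult_ac)
qed (simp add: poly_ring_def distrib_right)

definition monomials :: "'v set \<Rightarrow> ('v, 'k::field) mpoly set" where
  "monomials V = {Poly_Mapping.single u 1 | u. Poly_Mapping.keys u \<subseteq> V}"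

definition monomial_ideal :: "'v set \<Rightarrow> ('v, 'k::field) mpoly set \<Rightarrow> bool" where
  "monomial_ideal V I \<longleftrightarrow> (\<exists>G\<subseteq>monomials V. I = Idl\<^bsub>poly_ring V\<^esub> G)"

definition squarefree_monomial_ideal :: "'v set \<Rightarrow> ('v, 'k::field) mpoly set \<Rightarrow> bool" where
  "squarefree_monomial_ideal V I \<longleftrightarrow>
    (\<exists>\<S>. (\<forall>S\<in>\<S>. finite S \<and> S \<subseteq> V) \<and> I = Idl\<^bsub>poly_ring V\<^esub> ((\<lambda>S. \<Prod>v\<in>S. pvar v) ` \<S>))"

definition artin_monomial_ideal :: "'v set \<Rightarrow> ('v, 'k::field) mpoly set \<Rightarrow> bool" where
  "artin_monomial_ideal V I \<longleftrightarrow> monomial_ideal V I \<and> (\<forall>v\<in>V. \<exists>e. pvar v ^ e \<in> I)"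

definition irreducible_monomial_ideal :: "'v set \<Rightarrow> ('v, 'k::field) mpoly set \<Rightarrow> bool" where
  "irreducible_monomial_ideal V Q \<longleftrightarrow>
    (\<exists>S e. S \<subseteq> V \<and> (\<forall>v\<in>S. 1 \<le> e v) \<and> Q = Idl\<^bsub>poly_ring V\<^esub> {pvar v ^ e v | v. v \<in> S})"

text \<open>The intersection with the carrier only matters for the empty family, whose intersection is
  the unit ideal.\<close>

definition minimal_irreducible_decomposition ::
    "'v set \<Rightarrow> ('v, 'k::field) mpoly set \<Rightarrow> ('v, 'k) mpoly set set \<Rightarrow> bool" where
  "minimal_irreducible_decomposition V I \<D> \<longleftrightarrow>
    finite \<D> \<and> (\<forall>Q\<in>\<D>. irreducible_monomial_ideal V Q) \<and>
    I = carrier (poly_ring V) \<inter> \<Inter>\<D> \<and>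
    (\<forall>Q\<in>\<D>. carrier (poly_ring V) \<inter> \<Inter>(\<D> - {Q}) \<noteq> I)"

definition alexander_dual :: "'v set \<Rightarrow> ('v, 'k::field) mpoly set \<Rightarrow> ('v, 'k) mpoly set" where
  "alexander_dual V I = Idl\<^bsub>poly_ring V\<^esub>
    {p \<in> monomials V. \<forall>q \<in> I \<inter> monomials V. \<exists>d\<in>monomials V. d \<noteq> 1 \<and> d dvd p \<and> d dvd q}"

text \<open>Each element is a non-zero-divisor modulo \<open>I\<close> and its predecessors. The quotient by the
  whole sequence is not required to be non-zero; for linear forms and a homogeneous \<open>I\<close> that is
  automatic unless \<open>I\<close> is the unit ideal.\<close>

definition regular_sequence_mod ::
    "'v set \<Rightarrow> ('v, 'k::field) mpoly set \<Rightarrow> ('v, 'k) mpoly list \<Rightarrow> bool" where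
  "regular_sequence_mod V I fs \<longleftrightarrow>
    (\<forall>j<length fs. \<forall>g\<in>carrier (poly_ring V).
      fs ! j * g \<in> Idl\<^bsub>poly_ring V\<^esub> (I \<union> set (take j fs)) \<longrightarrow>
      g \<in> Idl\<^bsub>poly_ring V\<^esub> (I \<union> set (take j fs)))"


section \<open>Rainbow ideals and polarizations\<close>

text \<open>The colour classes are \<open>A 1, \<dots>, A n\<close>. Tuples \<open>(a\<^sub>1, \<dots>, a\<^sub>n)\<close> are extensional functions on
  \<open>{1..n}\<close>, and \<open>x\<^sub>1, \<dots>, x\<^sub>n\<close> are the variables \<open>pvar 1, \<dots>, pvar n\<close> of \<open>poly_ring {1..n}\<close>.\<close>

definition all_vars :: "nat \<Rightarrow> (nat \<Rightarrow> 'a set) \<Rightarrow> 'a set" where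
  "all_vars n A = (\<Union>i\<in>{1..n}. A i)"

definition rainbow_ideal ::
    "nat \<Rightarrow> (nat \<Rightarrow> 'a set) \<Rightarrow> (nat \<Rightarrow> 'a) set \<Rightarrow> ('a, 'k::field) mpoly set" where
  "rainbow_ideal n A T = Idl\<^bsub>poly_ring (all_vars n A)\<^esub> ((\<lambda>t. \<Prod>i=1..n. pvar (t i)) ` T)"

definition rainbow_dual ::
    "nat \<Rightarrow> (nat \<Rightarrow> 'a set) \<Rightarrow> (nat \<Rightarrow> 'a) set \<Rightarrow> ('a, 'k::field) mpoly set" where
  "rainbow_dual n A T = alexander_dual (all_vars n A) (rainbow_ideal n A T)"

definition colour :: "nat \<Rightarrow> (nat \<Rightarrow> 'a set) \<Rightarrow> 'a \<Rightarrow> nat" where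
  "colour n A a = (THE i. i \<in> {1..n} \<and> a \<in> A i)"

text \<open>The map \<open>k[A] \<rightarrow> k[x\<^sub>1, \<dots>, x\<^sub>n]\<close> sending each variable in \<open>A i\<close> to \<open>x\<^sub>i\<close>.\<close>

definition collapse ::
    "nat \<Rightarrow> (nat \<Rightarrow> 'a set) \<Rightarrow> ('a, 'k::field) mpoly \<Rightarrow> (nat, 'k) mpoly" where
  "collapse n A p =
    (\<Sum>u\<in>Poly_Mapping.keys p. poly_smult (Poly_Mapping.lookup p u)
      (\<Prod>a\<in>Poly_Mapping.keys u. pvar (colour n A a) ^ Poly_Mapping.lookup u a))"

definition variable_differences :: "nat \<Rightarrow> (nat \<Rightarrow> 'a set) \<Rightarrow> ('a, 'k::field) mpoly set" where
  "variable_differences n A = {pvar a - pvar b | a b. \<exists>i\<in>{1..n}. a \<in> A i \<and> b \<in> A i}"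

text \<open>\<open>fs\<close> is a basis, consisting of differences of variables of the same colour, of the kernel
  of \<^const>\<open>collapse\<close> on linear forms.\<close>

definition is_polarization ::
    "nat \<Rightarrow> (nat \<Rightarrow> 'a set) \<Rightarrow> ('a, 'k::field) mpoly set \<Rightarrow> (nat, 'k) mpoly set \<Rightarrow> bool" where
  "is_polarization n A J \<jj> \<longleftrightarrow>
    squarefree_monomial_ideal (all_vars n A) J \<and>
    collapse n A ` J = \<jj> \<and>
    (\<exists>fs. distinct fs \<and> set fs \<subseteq> variable_differences n A \<and>
      \<not> mpoly.dependent (set fs) \<and>
      mpoly.span (set fs) = {l \<in> mpoly.span (pvar ` all_vars n A). collapse n A l = 0} \<and>
      regular_sequence_mod (all_vars n A) J fs)"


section \<open>The cell complex and acyclicity\<close>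

text \<open>The cell \<open>\<Delta>(R\<^sub>1) \<times> \<cdots> \<times> \<Delta>(R\<^sub>n)\<close> is represented by the family \<open>R\<close> of its vertex sets,
  extensional on \<open>{1..n}\<close>; one cell is contained in another iff this holds for the vertex sets
  in each factor.\<close>

definition cells :: "nat \<Rightarrow> (nat \<Rightarrow> 'a set) \<Rightarrow> (nat \<Rightarrow> 'a) set \<Rightarrow> (nat \<Rightarrow> 'a set) set" where
  "cells n A T = {R \<in> PiE {1..n} (\<lambda>i. Pow (A i) - {{}}). PiE {1..n} R \<subseteq> T}"

definition maximal_cells ::
    "nat \<Rightarrow> (nat \<Rightarrow> 'a set) \<Rightarrow> (nat \<Rightarrow> 'a) set \<Rightarrow> (nat \<Rightarrow> 'a set) set" where
  "maximal_cells n A T =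
    {R \<in> cells n A T. \<forall>S\<in>cells n A T. (\<forall>i\<in>{1..n}. R i \<subseteq> S i) \<longrightarrow> S = R}"

definition cell_dim :: "nat \<Rightarrow> (nat \<Rightarrow> 'a set) \<Rightarrow> nat" where
  "cell_dim n R = (\<Sum>i=1..n. card (R i) - 1)"

definition chains ::
    "nat \<Rightarrow> (nat \<Rightarrow> 'a set) \<Rightarrow> (nat \<Rightarrow> 'a) set \<Rightarrow> nat \<Rightarrow> ((nat \<Rightarrow> 'a set) \<Rightarrow> 'k::field) set" where
  "chains n A T d = {c. \<forall>R. c R \<noteq> 0 \<longrightarrow> R \<in> cells n A T \<and> cell_dim n R = d}"

text \<open>The simplices are oriented by the enumerations \<^term>\<open>to_nat_on (A i)\<close> of the finite sets
  \<open>A i\<close> (an arbitrary choice), and the cells by the product orientation: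
  the facet of \<open>R\<close> obtained by deleting the \<open>p\<close>-th vertex (counting from 0) of the factor \<open>R i\<close>
  has incidence number \<open>(-1)^(\<Sum>j<i. dim \<Delta>(R j) + p)\<close>. \<open>incidence A F i r\<close> is
  the incidence number of \<open>F\<close> in \<open>F(i := insert r (F i))\<close>.\<close>

definition incidence ::
    "(nat \<Rightarrow> 'a set) \<Rightarrow> (nat \<Rightarrow> 'a set) \<Rightarrow> nat \<Rightarrow> 'a \<Rightarrow> 'k::field" where
  "incidence A F i r =
    (- 1) ^ ((\<Sum>j=1..<i. card (F j) - 1) +
      card {s \<in> F i. to_nat_on (A i) s < to_nat_on (A i) r})"

definition boundary ::
    "nat \<Rightarrow> (nat \<Rightarrow> 'a set) \<Rightarrow> (nat \<Rightarrow> 'a) set \<Rightarrow>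
      ((nat \<Rightarrow> 'a set) \<Rightarrow> 'k::field) \<Rightarrow> ((nat \<Rightarrow> 'a set) \<Rightarrow> 'k)" where
  "boundary n A T c F =
    (if F \<in> cells n A T
     then \<Sum>i=1..n. \<Sum>r\<in>A i - F i. incidence A F i r * c (F(i := insert r (F i)))
     else 0)"

text \<open>In degree 0 the boundary map of the reduced complex is the augmentation.\<close>

definition reduced_cycles ::
    "nat \<Rightarrow> (nat \<Rightarrow> 'a set) \<Rightarrow> (nat \<Rightarrow> 'a) set \<Rightarrow> nat \<Rightarrow> ((nat \<Rightarrow> 'a set) \<Rightarrow> 'k::field) set" where
  "reduced_cycles n A T d =
    {c \<in> chains n A T d.
      if d = 0 then (\<Sum>R\<in>cells n A T. c R) = 0 else boundary n A T c = (\<lambda>_. 0)}"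

definition reduced_homology_vanishes ::
    "'k::field itself \<Rightarrow> nat \<Rightarrow> (nat \<Rightarrow> 'a set) \<Rightarrow> (nat \<Rightarrow> 'a) set \<Rightarrow> nat \<Rightarrow> bool" where
  "reduced_homology_vanishes _ n A T d \<longleftrightarrow>
    (reduced_cycles n A T d :: ((nat \<Rightarrow> 'a set) \<Rightarrow> 'k) set) = boundary n A T ` chains n A T (d + 1)"

definition acyclic_subset ::
    "'k::field itself \<Rightarrow> nat \<Rightarrow> (nat \<Rightarrow> 'a set) \<Rightarrow> (nat \<Rightarrow> 'a) set \<Rightarrow> bool" where
  "acyclic_subset k n A T \<longleftrightarrow>
    (\<forall>R. (\<forall>i\<in>{1..n}. R i \<noteq> {} \<and> R i \<subseteq> A i) \<longrightarrow>
      (\<forall>d. reduced_homology_vanishes k n A (T \<inter> PiE {1..n} R) d))"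


section \<open>The irreducible ideal of a cell\<close>

definition cell_ideal :: "nat \<Rightarrow> (nat \<Rightarrow> 'a set) \<Rightarrow> (nat, 'k::field) mpoly set" where
  "cell_ideal n R = Idl\<^bsub>poly_ring {1..n}\<^esub> {pvar i ^ card (R i) | i. i \<in> {1..n}}"

end

theory Submission
  imports Defs "HOL-Library.Function_Algebras"
begin

text \<open>Acyclicity enters only through Euler characteristics: \<open>T \<inter> (R\<^sub>1 \<times> \<dots> \<times> R\<^sub>n)\<close> has Euler
  characteristic 1 unless it is empty. Moebius inversion over one factor after the other turns
  this into a quantifier exchange: if every choice of coordinates in an index set \<open>I\<close> extends to a
  point of \<open>T\<close> with the remaining coordinates in prescribed sets, then one choice of the remaining
  coordinates works for all choices on \<open>I\<close>. Two consequences give the theorem.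

  A monomial \<open>x\<^sup>w\<close> lies outside the image of \<open>J(T)\<close> iff, whenever at most \<open>w\<^sub>i\<close> elements are deleted
  from each \<open>A\<^sub>i\<close>, some point of \<open>T\<close> survives; exchanging quantifiers one coordinate at a time, this
  holds iff \<open>T\<close> contains a cell with \<open>w\<^sub>i + 1\<close> vertices in the \<open>i\<close>-th factor. So \<open>\<jj>\<close> is the
  intersection of the ideals of the maximal cells. Secondly, a maximal cell is the only cell with its
  sizes: if another cell of the same sizes differed in the \<open>i\<close>-th factor, exchange would produce a cell
  of the same sizes except for one more vertex in the \<open>i\<close>-th factor, and by induction on the number of
  differing factors this would be an enlargement of the maximal cell. Hence the sizes of distinct maximal
  cells are incomparable, which is irredundance.\<close>

section \<open>Euler characteristics\<close>

text \<open>Chains of all degrees live in one function space that may have infinite dimension, so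
  rank-nullity is needed for a map restricted to a finite-dimensional subspace. A basis
  \<open>B0\<close> of the kernel inside \<open>S\<close> is extended to a basis \<open>B\<close> of
  \<open>S\<close>; the part \<open>C\<close> added is mapped injectively onto a basis of the
  image.\<close>

lemma (in vector_space) rank_nullity_on:
  assumes f: "Vector_Spaces.linear scale scale f" and S: "subspace S" and W: "finite W" "S \<subseteq> span W"
  shows "dim S = dim {x \<in> S. f x = 0} + dim (f ` S)"
proof -
  interpret f: Vector_Spaces.linear scale scale f by fact
  define K where "K = {x \<in> S. f x = 0}"
  obtain B0 where B0: "B0 \<subseteq> K" "independent B0" "K \<subseteq> span B0"
    using maximal_independent_subset[of K] by blast
  have "B0 \<subseteq> S" using B0 by (auto simp: K_def)
  then obtain B where B: "B0 \<subseteq> B" "B \<subseteq> S" "independent B" "S \<subseteq> span B"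
    using maximal_independent_subset_extend[of B0 S] B0(2) by metis
  have finB: "finite B"
    using independent_span_bound[OF W(1) B(3)] B(2) W(2) by blast
  define C where "C = B - B0"
  have fin: "finite C" "finite B0" using finB B(1) finite_subset unfolding C_def by auto
  have CB: "C \<subseteq> B" by (auto simp: C_def)
  have spanC_S: "span C \<subseteq> S"
    using B(2) CB S by (intro span_minimal) auto
  have inj0: "x = 0" if x: "x \<in> span C" "f x = 0" for x
  proof -
    have "x \<in> span B0" using x spanC_S B0(3) by (auto simp: K_def)
    then obtain w where w: "x = (\<Sum>v\<in>B0. w v *s v)" unfolding span_finite[OF fin(2)] by blast
    obtain u where u: "x = (\<Sum>v\<in>C. u v *s v)" using x(1) unfolding span_finite[OF fin(1)] by blast
    \<comment> \<open>The vector \<open>x\<close> has an expansion over \<open>C\<close> and one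
      over \<open>B0\<close>. Their difference, with coefficients \<open>g\<close>, is a linear
      relation on the independent set \<open>B\<close>.\<close>
    define g where "g v = (if v \<in> C then u v else - w v)" for v
    have "(\<Sum>v\<in>B. g v *s v) = (\<Sum>v\<in>C. g v *s v) + (\<Sum>v\<in>B0. g v *s v)"
      unfolding C_def using B(1) finB by (rule sum.subset_diff)
    also have "(\<Sum>v\<in>C. g v *s v) = x" unfolding u by (rule sum.cong) (auto simp: g_def)
    also have "(\<Sum>v\<in>B0. g v *s v) = - x" unfolding w sum_negf[symmetric]
      by (rule sum.cong) (auto simp: g_def C_def)
    finally have "(\<Sum>v\<in>B. g v *s v) = 0" by simp
    then have "g v = 0" if "v \<in> B" for v
      using independentD[OF B(3) finB subset_refl] that by blast
    then have "u v = 0" if "v \<in> C" for v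
      using that CB unfolding g_def by (metis (full_types) subsetD)
    then show "x = 0" unfolding u by (intro sum.neutral) simp
  qed
  have inj: "inj_on f (span C)"
  proof (rule inj_onI)
    fix x y assume "x \<in> span C" "y \<in> span C" "f x = f y"
    then have "x - y \<in> span C" "f (x - y) = 0" by (simp_all add: span_diff f.diff)
    then have "x - y = 0" by (rule inj0)
    then show "x = y" by simp
  qed
  have "f ` S \<subseteq> span (f ` C)"
  proof
    fix y assume "y \<in> f ` S"
    then obtain x where x: "x \<in> S" "y = f x" by blast
    then have "x \<in> span (B0 \<union> C)" using B(1,4) by (auto simp: C_def Un_absorb1)
    then obtain p q where pq: "x = p + q" "p \<in> span B0" "q \<in> span C"
      unfolding span_Un by blast
    have "f p = 0"
    proof -
      have "span B0 \<subseteq> {x. f x = 0}" using B0(1)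
        by (intro span_minimal f.subspace_kernel) (auto simp: K_def)
      then show ?thesis using pq by auto
    qed
    then have "y = f q" using x pq by (simp add: f.add)
    then show "y \<in> span (f ` C)" using pq by (simp add: f.span_image)
  qed
  moreover have "f ` C \<subseteq> f ` S" using CB B by auto
  moreover have "independent (f ` C)"
    using f.independent_injective_image[OF independent_mono[OF B(3) CB] inj] .
  ultimately have "card (f ` C) = dim (f ` S)" by (intro basis_card_eq_dim) auto
  moreover have "card (f ` C) = card C"
    by (rule card_image, rule inj_on_subset[OF inj span_superset])
  moreover have "card B0 = dim K" using B0 by (intro basis_card_eq_dim) auto
  moreover have "card B = dim S" using B by (intro basis_card_eq_dim) auto
  moreover have "card B = card B0 + card C"
    unfolding C_def using B(1) finB fin by (simp add: card_Diff_subset card_mono)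
  ultimately show ?thesis unfolding K_def by linarith
qed

definition fun_smult :: "'k::field \<Rightarrow> ('b \<Rightarrow> 'k) \<Rightarrow> 'b \<Rightarrow> 'k" where
  "fun_smult c f = (\<lambda>x. c * f x)"

interpretation fs: vector_space "fun_smult :: 'k::field \<Rightarrow> ('b \<Rightarrow> 'k) \<Rightarrow> 'b \<Rightarrow> 'k"
  by unfold_locales (simp_all add: fun_smult_def fun_eq_iff algebra_simps)

lemma subspace_supported: "fs.subspace {f :: 'b \<Rightarrow> 'k::field. \<forall>x. f x \<noteq> 0 \<longrightarrow> x \<in> X}"
  by (auto simp: fs.subspace_def fun_smult_def) (metis add.right_neutral)

text \<open>The indicator functions \<open>e x\<close> of the points of \<open>X\<close> form a
  basis. The second conclusion supplies the finite spanning set that \<open>rank_nullity_on\<close>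
  asks for.\<close>

lemma
  assumes "finite X"
  shows dim_supported: "fs.dim {f :: 'b \<Rightarrow> 'k::field. \<forall>x. f x \<noteq> 0 \<longrightarrow> x \<in> X} = card X"
    and supported_subset_span: "\<exists>W. finite W \<and>
      {f :: 'b \<Rightarrow> 'k. \<forall>x. f x \<noteq> 0 \<longrightarrow> x \<in> X} \<subseteq> fs.span W"
proof -
  define V where "V = {f :: 'b \<Rightarrow> 'k. \<forall>x. f x \<noteq> 0 \<longrightarrow> x \<in> X}"
  define e :: "'b \<Rightarrow> 'b \<Rightarrow> 'k" where "e x = (\<lambda>y. if y = x then 1 else 0)" for x
  have e_inj: "inj_on e X" by (rule inj_onI) (auto simp: e_def fun_eq_iff split: if_splits)
  have comb: "(\<Sum>v\<in>e ` X. fun_smult (u v) v) y = (if y \<in> X then u (e y) else 0)" for u y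
  proof -
    have "(\<Sum>v\<in>e ` X. fun_smult (u v) v) = (\<Sum>x\<in>X. fun_smult (u (e x)) (e x))"
      using e_inj by (simp add: sum.reindex)
    moreover have "(\<Sum>x\<in>Y. fun_smult (u (e x)) (e x)) y = (\<Sum>x\<in>Y. if y = x then u (e x) else 0)" for Y
      by (induction Y rule: infinite_finite_induct) (auto simp: fun_smult_def e_def)
    ultimately show ?thesis using assms by simp
  qed
  have sp: "V \<subseteq> fs.span (e ` X)"
  proof
    fix f assume f: "f \<in> V"
    have "f = (\<Sum>v\<in>e ` X. fun_smult (f (inv_into X e v)) v)"
    proof
      fix y
      show "f y = (\<Sum>v\<in>e ` X. fun_smult (f (inv_into X e v)) v) y"
        unfolding comb using f inv_into_f_f[OF e_inj] by (cases "y \<in> X") (auto simp: V_def)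
    qed
    also have "\<dots> \<in> fs.span (e ` X)" by (intro fs.span_sum fs.span_scale fs.span_base)
    finally show "f \<in> fs.span (e ` X)" .
  qed
  have ind: "fs.independent (e ` X)"
  proof (rule fs.independent_if_scalars_zero)
    show "finite (e ` X)" using assms by simp
    fix u v assume "(\<Sum>v\<in>e ` X. fun_smult (u v) v) = 0" "v \<in> e ` X"
    then show "u v = 0" using comb[of u] by (auto split: if_splits) (metis zero_fun_apply)
  qed
  have "e ` X \<subseteq> V" by (auto simp: V_def e_def split: if_splits)
  with sp ind e_inj show "fs.dim V = card X"
    by (metis fs.basis_card_eq_dim card_image)
  show "\<exists>W. finite W \<and> V \<subseteq> fs.span W" using sp assms by blast
qed

section \<open>From vanishing homology to the Euler characteristic\<close>

lemma linear_boundary: "Vector_Spaces.linear fun_smult fun_smult (boundary n A T)"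
  by unfold_locales
    (auto simp: boundary_def fun_smult_def fun_eq_iff algebra_simps sum.distrib sum_distrib_left)

lemma finite_cells:
  assumes "\<And>i. i \<in> {1..n} \<Longrightarrow> finite (A i)"
  shows "finite (cells n A T)"
  unfolding cells_def by (rule finite_subset[OF _ finite_PiE[of "{1..n}" "\<lambda>i. Pow (A i) - {{}}"]]) (auto simp: assms)

lemma chains_eq: "chains n A T d = {c. \<forall>R. c R \<noteq> 0 \<longrightarrow> R \<in> {R \<in> cells n A T. cell_dim n R = d}}"
  by (simp add: chains_def)

text \<open>The Euler-Poincare argument: every cycle is a boundary, so rank-nullity expresses the
  number of cells of dimension \<open>d + 1\<close> as the sum of the dimensions of the cycle spaces
  in degrees \<open>d + 1\<close> and \<open>d\<close>. The alternating sum telescopes, and only the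
  rank of the augmentation in degree 0 is left.\<close>

lemma euler_characteristic_cells:
  assumes fin: "\<And>i. i \<in> {1..n} \<Longrightarrow> finite (A i)"
    and vanish: "\<And>d. reduced_homology_vanishes TYPE('k::field) n A T d"
  shows "(\<Sum>R\<in>cells n A T. (- 1) ^ cell_dim n R) = (if cells n A T = {} then 0 else 1 :: int)"
proof -
  define X where "X = cells n A T"
  define Xd where "Xd d = {R \<in> X. cell_dim n R = d}" for d
  define C where "C d = (chains n A T d :: ((nat \<Rightarrow> 'a set) \<Rightarrow> 'k) set)" for d
  define Z where "Z d = (reduced_cycles n A T d :: ((nat \<Rightarrow> 'a set) \<Rightarrow> 'k) set)" for d
  have finX: "finite X" unfolding X_def using fin by (rule finite_cells)
  have finXd: "finite (Xd d)" for d using finX by (simp add: Xd_def)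
  have C_eq: "C d = {c. \<forall>R. c R \<noteq> 0 \<longrightarrow> R \<in> Xd d}" for d
    unfolding C_def chains_eq Xd_def X_def ..
  have dimC: "fs.dim (C d) = card (Xd d)" for d unfolding C_eq using finXd by (rule dim_supported)
  have spanC: "\<exists>W. finite W \<and> C d \<subseteq> fs.span W" for d
    unfolding C_eq using finXd by (rule supported_subset_span)
  have subC: "fs.subspace (C d)" for d unfolding C_eq by (rule subspace_supported)
  have ZB: "Z d = boundary n A T ` C (Suc d)" for d
    using vanish[of d] unfolding reduced_homology_vanishes_def Z_def C_def by simp
  have step: "card (Xd (Suc d)) = fs.dim (Z (Suc d)) + fs.dim (Z d)" for d
  proof -
    obtain W where "finite W" "C (Suc d) \<subseteq> fs.span W" using spanC by blast
    from fs.rank_nullity_on[OF linear_boundary[of n A T] subC this]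
    have "fs.dim (C (Suc d)) =
        fs.dim {x \<in> C (Suc d). boundary n A T x = 0} + fs.dim (boundary n A T ` C (Suc d))" .
    moreover have "{x \<in> C (Suc d). boundary n A T x = 0} = Z (Suc d)"
      by (simp add: Z_def reduced_cycles_def C_def zero_fun_def)
    ultimately show ?thesis using dimC ZB by simp
  qed
  have base: "card (Xd 0) = fs.dim (Z 0) + (if Xd 0 = {} then 0 else 1)"
  proof -
    \<comment> \<open>The augmentation takes values in the functions supported at one arbitrary point.\<close>
    define aug :: "((nat \<Rightarrow> 'a set) \<Rightarrow> 'k) \<Rightarrow> (nat \<Rightarrow> 'a set) \<Rightarrow> 'k"
      where "aug c = (\<lambda>F. if F = (\<lambda>_. {}) then \<Sum>R\<in>X. c R else 0)" for c
    have lin: "Vector_Spaces.linear fun_smult fun_smult aug"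
      by unfold_locales
        (auto simp: aug_def fun_smult_def fun_eq_iff algebra_simps sum.distrib sum_distrib_left)
    obtain W where "finite W" "C 0 \<subseteq> fs.span W" using spanC by blast
    from fs.rank_nullity_on[OF lin subC this]
    have "fs.dim (C 0) = fs.dim {x \<in> C 0. aug x = 0} + fs.dim (aug ` C 0)" .
    moreover have "{x \<in> C 0. aug x = 0} = Z 0"
      by (auto simp: Z_def reduced_cycles_def C_def aug_def X_def fun_eq_iff)
    moreover have "aug ` C 0 =
        (if Xd 0 = {} then {f. \<forall>x. f x \<noteq> 0 \<longrightarrow> x \<in> {}} else {f. \<forall>x. f x \<noteq> 0 \<longrightarrow> x \<in> {\<lambda>_. {}}})"
    proof (cases "Xd 0 = {}")
      case True
      then have "C 0 = {\<lambda>_. 0}" by (auto simp: C_eq)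
      then show ?thesis using True by (auto simp: aug_def)
    next
      case False
      then obtain R0 where R0: "R0 \<in> Xd 0" by blast
      have "f \<in> aug ` C 0" if f: "\<forall>x. f x \<noteq> 0 \<longrightarrow> x = (\<lambda>_. {})" for f
      proof
        let ?c = "\<lambda>R. if R = R0 then f (\<lambda>_. {}) else 0"
        show "?c \<in> C 0" using R0 by (auto simp: C_eq)
        have "(\<Sum>R\<in>X. ?c R) = f (\<lambda>_. {})" using R0 finX by (simp add: Xd_def)
        then have "aug ?c x = f x" for x using f by (cases "x = (\<lambda>_. {})") (auto simp: aug_def)
        then show "f = aug ?c" by (simp add: fun_eq_iff)
      qed
      then show ?thesis using False by (auto simp: aug_def split: if_splits)
    qed
    ultimately show ?thesis
      using dimC[of 0] dim_supported[where ?'k='k, of "{} :: (nat \<Rightarrow> 'a set) set"]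
        dim_supported[where ?'k='k, of "{\<lambda>_ :: nat. {} :: 'a set}"] by simp
  qed
  obtain N where N: "\<And>R. R \<in> X \<Longrightarrow> cell_dim n R \<le> N"
    using finX by (meson finite_nat_set_iff_bounded_le finite_imageI imageI)
  have empty: "Xd d = {}" if "d > N" for d using N that by (fastforce simp: Xd_def)
  \<comment> \<open>The telescoped partial sum keeps the last cycle space \<open>Z M\<close>. For
    \<open>M = Suc N\<close> there are no cells of that dimension, so this term is zero.\<close>
  have "(\<Sum>d\<le>M. (- 1) ^ d * int (card (Xd d))) =
      (if Xd 0 = {} then 0 else 1) + (- 1) ^ M * int (fs.dim (Z M))" for M
    by (induction M) (auto simp: step base algebra_simps)
  from this[of "Suc N"] have "(\<Sum>d\<le>Suc N. (- 1) ^ d * int (card (Xd d))) = (if Xd 0 = {} then 0 else 1)"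
    using step[of N] empty[of "Suc N"] by simp
  moreover have "(\<Sum>R\<in>X. (- 1) ^ cell_dim n R) = (\<Sum>d\<le>Suc N. (- 1) ^ d * int (card (Xd d)))"
  proof -
    have "(\<Sum>R\<in>X. (- 1) ^ cell_dim n R) = (\<Sum>d\<le>Suc N. \<Sum>R\<in>{R\<in>X. cell_dim n R = d}. (- 1 :: int) ^ cell_dim n R)"
      using N finX by (subst sum.group) (auto intro: le_SucI)
    also have "\<dots> = (\<Sum>d\<le>Suc N. (- 1) ^ d * int (card (Xd d)))"
      by (rule sum.cong) (auto simp: Xd_def)
    finally show ?thesis .
  qed
  \<comment> \<open>The augmentation has rank 1 as soon as there is a vertex, and every cell
    contains one: choose one point in each factor.\<close>
  moreover have "Xd 0 = {} \<longleftrightarrow> X = {}"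
  proof
    assume X0: "Xd 0 = {}"
    show "X = {}"
    proof (rule ccontr)
      assume "X \<noteq> {}"
      then obtain R where R: "R \<in> cells n A T" by (auto simp: X_def)
      define F where "F = (\<lambda>i\<in>{1..n}. {SOME a. a \<in> R i})"
      have F: "F i \<subseteq> R i \<and> F i \<noteq> {} \<and> card (F i) = 1" if "i \<in> {1..n}" for i
        using R that by (auto simp: cells_def F_def PiE_iff some_in_eq)
      have "F i \<in> Pow (A i) - {{}}" if "i \<in> {1..n}" for i
      proof -
        have "R i \<subseteq> A i" using R that by (auto simp: cells_def PiE_iff)
        then show ?thesis using F[OF that] by blast
      qed
      moreover have "F \<in> extensional {1..n}" by (simp add: F_def)
      moreover have "PiE {1..n} F \<subseteq> PiE {1..n} R" using F by (intro PiE_mono) blast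
      ultimately have "F \<in> cells n A T" using R by (auto simp: cells_def PiE_iff)
      moreover have "cell_dim n F = 0" using F by (simp add: cell_dim_def)
      ultimately show False using X0 by (auto simp: Xd_def X_def)
    qed
  qed (auto simp: Xd_def)
  ultimately show ?thesis by (simp add: X_def)
qed

section \<open>Exchange of quantifiers\<close>

text \<open>This is the Euler characteristic of the simplex on the elements satisfying
  \<open>h\<close>. It comes from expanding the product of the factors
  \<open>1 - of_bool (h a)\<close>, in which the empty set contributes the 1.\<close>

lemma sum_Pow_all_eq_ex:
  assumes "finite X"
  shows "(\<Sum>Y\<in>Pow X - {{}}. (- 1) ^ (card Y - 1) * of_bool (\<forall>a\<in>Y. h a)) = (of_bool (\<exists>a\<in>X. h a) :: int)"
proof -
  have prod_of_bool: "(\<Prod>a\<in>Y. - of_bool (h a) :: int) = (- 1) ^ card Y * of_bool (\<forall>a\<in>Y. h a)"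
    if "finite Y" for Y
    using that by induction auto
  have "(\<Prod>a\<in>X. - of_bool (h a) + 1 :: int) =
      (\<Sum>Y\<in>Pow X. (\<Prod>a\<in>Y. - of_bool (h a)) * (\<Prod>a\<in>X - Y. 1))"
    using assms by (rule prod_add)
  also have "\<dots> = (\<Sum>Y\<in>Pow X. (- 1) ^ card Y * of_bool (\<forall>a\<in>Y. h a))"
    using assms by (intro sum.cong) (auto simp: prod_of_bool finite_subset)
  also have "\<dots> = 1 + (\<Sum>Y\<in>Pow X - {{}}. (- 1) ^ card Y * of_bool (\<forall>a\<in>Y. h a))"
    using assms by (subst sum.remove[of _ "{}"]) auto
  also have "(\<Sum>Y\<in>Pow X - {{}}. (- 1) ^ card Y * of_bool (\<forall>a\<in>Y. h a)) =
      - (\<Sum>Y\<in>Pow X - {{}}. (- 1) ^ (card Y - 1) * of_bool (\<forall>a\<in>Y. h a) :: int)"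
    unfolding sum_negf[symmetric]
  proof (rule sum.cong)
    fix Y assume "Y \<in> Pow X - {{}}"
    then have "card Y > 0" using assms finite_subset by (auto simp: card_gt_0_iff)
    then have "(- 1 :: int) ^ card Y = - ((- 1) ^ (card Y - 1))" by (cases "card Y") auto
    then show "(- 1) ^ card Y * of_bool (\<forall>a\<in>Y. h a) =
        - ((- 1) ^ (card Y - 1) * of_bool (\<forall>a\<in>Y. h a) :: int)" by simp
  qed simp
  also have "(\<Prod>a\<in>X. - of_bool (h a) + 1 :: int) = of_bool (\<not> (\<exists>a\<in>X. h a))"
    using assms by induction auto
  finally show ?thesis unfolding of_bool_not_iff by linarith
qed

text \<open>Only the uniqueness half of Moebius inversion is needed: by induction the proper subsets
  contribute equally to both sums, and the term of \<open>X\<close> itself has coefficient 1 or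
  -1.\<close>

lemma sum_Pow_unique:
  fixes f g :: "'a set \<Rightarrow> int"
  assumes "finite X" "X \<noteq> {}"
    and "\<And>Y. Y \<subseteq> X \<Longrightarrow> Y \<noteq> {} \<Longrightarrow>
      (\<Sum>Z\<in>Pow Y - {{}}. (- 1) ^ (card Z - 1) * f Z) = (\<Sum>Z\<in>Pow Y - {{}}. (- 1) ^ (card Z - 1) * g Z)"
  shows "f X = g X"
  using assms
proof (induction X rule: finite_psubset_induct)
  case (psubset X)
  have IH: "f Z = g Z" if "Z \<subset> X" "Z \<noteq> {}" for Z
    using that psubset.prems by (intro psubset.IH) auto
  have split: "(\<Sum>Z\<in>Pow X - {{}}. (- 1) ^ (card Z - 1) * k Z) =
      (- 1) ^ (card X - 1) * k X + (\<Sum>Z\<in>Pow X - {{}} - {X}. (- 1) ^ (card Z - 1) * k Z)" for k :: "'a set \<Rightarrow> int"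
    using psubset.hyps psubset.prems(1) by (intro sum.remove) auto
  have "(\<Sum>Z\<in>Pow X - {{}} - {X}. (- 1) ^ (card Z - 1) * f Z) =
      (\<Sum>Z\<in>Pow X - {{}} - {X}. (- 1) ^ (card Z - 1) * g Z)"
    using IH by (intro sum.cong) auto
  then have "(- 1) ^ (card X - 1) * f X = (- 1) ^ (card X - 1) * g X"
    using psubset.prems(2)[OF subset_refl psubset.prems(1)] unfolding split by simp
  then show ?case by simp
qed

text \<open>The two notions differ in the order of the quantifiers: in \<open>forces\<close> the coordinates in \<open>D - I\<close> are
  chosen before those in \<open>I\<close>. The values on \<open>I\<close> of its witness \<open>t\<close> are irrelevant.\<close>

definition forces :: "nat set \<Rightarrow> (nat \<Rightarrow> 'a) set \<Rightarrow> nat set \<Rightarrow> (nat \<Rightarrow> 'a set) \<Rightarrow> bool" where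
  "forces D T I R \<longleftrightarrow> (\<exists>t\<in>PiE D R. \<forall>s\<in>PiE D R. (\<forall>i\<in>D - I. s i = t i) \<longrightarrow> s \<in> T)"

definition answers :: "nat set \<Rightarrow> (nat \<Rightarrow> 'a) set \<Rightarrow> nat set \<Rightarrow> (nat \<Rightarrow> 'a set) \<Rightarrow> bool" where
  "answers D T I R \<longleftrightarrow> (\<forall>s\<in>PiE D R. \<exists>t\<in>PiE D R. (\<forall>i\<in>I. t i = s i) \<and> t \<in> T)"

definition subcells :: "nat set \<Rightarrow> (nat \<Rightarrow> 'a) set \<Rightarrow> nat set \<Rightarrow> (nat \<Rightarrow> 'a set) \<Rightarrow> (nat \<Rightarrow> 'a set) set" where
  "subcells D T I R = {S \<in> PiE D (\<lambda>i. Pow (R i) - {{}}). (\<forall>i\<in>I. S i = R i) \<and> PiE D S \<subseteq> T}"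

text \<open>For \<open>I = {}\<close> this is the Euler characteristic of the cells of
  \<open>T\<close> inside the box \<open>R\<close>. Moving an index into \<open>I\<close> undoes the
  alternating summation over that factor, see \<open>partial_euler_insert\<close>.\<close>

definition partial_euler :: "nat set \<Rightarrow> (nat \<Rightarrow> 'a) set \<Rightarrow> nat set \<Rightarrow> (nat \<Rightarrow> 'a set) \<Rightarrow> int" where
  "partial_euler D T I R = (\<Sum>S\<in>subcells D T I R. \<Prod>j\<in>D - I. (- 1) ^ (card (S j) - 1))"

lemma forces_imp_answers:
  assumes "forces D T I R" "I \<subseteq> D"
  shows "answers D T I R"
  unfolding answers_def
proof
  fix s assume s: "s \<in> PiE D R"
  obtain t where t: "t \<in> PiE D R" "\<And>s. s \<in> PiE D R \<Longrightarrow> (\<forall>i\<in>D - I. s i = t i) \<Longrightarrow> s \<in> T"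
    using assms(1) unfolding forces_def by blast
  define u where "u i = (if i \<in> I then s i else t i)" for i
  have "u \<in> PiE D R" using s t(1) assms(2) by (auto simp: u_def PiE_iff extensional_def)
  moreover from this have "u \<in> T" by (rule t(2)) (simp add: u_def)
  ultimately show "\<exists>t\<in>PiE D R. (\<forall>i\<in>I. t i = s i) \<and> t \<in> T" by (auto simp: u_def intro!: bexI[of _ u])
qed

text \<open>A non-zero sum has a summand, hence a cell that fills the box in the directions of
  \<open>I\<close>. Any vertex of this cell is a witness, since changing its coordinates in
  \<open>I\<close> does not leave the cell.\<close>

lemma partial_euler_nonzero_imp_forces:
  assumes "partial_euler D T I R \<noteq> 0"
  shows "forces D T I R"
proof -
  have "subcells D T I R \<noteq> {}" using assms by (auto simp: partial_euler_def)
  then obtain S where S: "S \<in> PiE D (\<lambda>i. Pow (R i) - {{}})" "\<And>i. i \<in> I \<Longrightarrow> S i = R i" "PiE D S \<subseteq> T"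
    unfolding subcells_def by blast
  have SR: "S i \<subseteq> R i" "S i \<noteq> {}" if "i \<in> D" for i using S(1) that by (auto simp: PiE_iff)
  obtain t where t: "t \<in> PiE D S" using SR(2) PiE_eq_empty_iff[of D S] by blast
  have "s \<in> T" if s: "s \<in> PiE D R" "\<forall>i\<in>D - I. s i = t i" for s
  proof -
    have "s i \<in> S i" if "i \<in> D" for i
      using that s t S(2) by (cases "i \<in> I") (auto simp: PiE_iff)
    then have "s \<in> PiE D S" using s(1) by (auto simp: PiE_iff)
    then show ?thesis using S(3) by blast
  qed
  moreover have "t \<in> PiE D R" using t SR(1) by (auto simp: PiE_iff)
  ultimately show ?thesis unfolding forces_def by blast
qed

text \<open>A coordinate outside \<open>I\<close> is chosen existentially at the outermost level, so
  its value can be fixed first. In \<open>answers_insert_iff\<close> the coordinate is quantified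
  universally, and the disjunction becomes a conjunction.\<close>

lemma forces_iff_singleton:
  assumes "i \<in> D" "i \<notin> I"
  shows "forces D T I R \<longleftrightarrow> (\<exists>a\<in>R i. forces D T I (R(i := {a})))"
proof
  assume "forces D T I R"
  then obtain t where t: "t \<in> PiE D R" "\<And>s. s \<in> PiE D R \<Longrightarrow> (\<forall>i\<in>D - I. s i = t i) \<Longrightarrow> s \<in> T"
    unfolding forces_def by blast
  have sub: "PiE D (R(i := {t i})) \<subseteq> PiE D R" using t(1) assms by (intro PiE_mono) (auto simp: PiE_iff)
  have "t \<in> PiE D (R(i := {t i}))" using t(1) by (auto simp: PiE_iff)
  then have "forces D T I (R(i := {t i}))" using t(2) sub unfolding forces_def by blast
  then show "\<exists>a\<in>R i. forces D T I (R(i := {a}))" using t(1) assms by (auto simp: PiE_iff)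
next
  assume "\<exists>a\<in>R i. forces D T I (R(i := {a}))"
  then obtain a t where a: "a \<in> R i" and t: "t \<in> PiE D (R(i := {a}))"
    "\<And>s. s \<in> PiE D (R(i := {a})) \<Longrightarrow> (\<forall>i\<in>D - I. s i = t i) \<Longrightarrow> s \<in> T"
    unfolding forces_def by blast
  have ti: "t i = a" using t(1) assms by (auto simp: PiE_iff)
  have "s \<in> T" if s: "s \<in> PiE D R" "\<forall>i\<in>D - I. s i = t i" for s
  proof (rule t(2)[OF _ s(2)])
    have "s i = a" using s(2) assms ti by auto
    then show "s \<in> PiE D (R(i := {a}))" using s(1) by (auto simp: PiE_iff)
  qed
  moreover have "t j \<in> R j" if "j \<in> D" for j
    using t(1) that a by (cases "j = i") (auto simp: PiE_iff)
  then have "t \<in> PiE D R" using t(1) by (auto simp: PiE_iff)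
  ultimately show "forces D T I R" unfolding forces_def by blast
qed

lemma answers_insert_iff:
  assumes "i \<in> D"
  shows "answers D T (insert i I) R \<longleftrightarrow> (\<forall>a\<in>R i. answers D T I (R(i := {a})))"
proof
  assume *: "answers D T (insert i I) R"
  show "\<forall>a\<in>R i. answers D T I (R(i := {a}))"
    unfolding answers_def
  proof (intro ballI)
    fix a s assume a: "a \<in> R i" and s: "s \<in> PiE D (R(i := {a}))"
    have si: "s i = a" using s assms by (auto simp: PiE_iff)
    have "s j \<in> R j" if "j \<in> D" for j using s that a by (cases "j = i") (auto simp: PiE_iff)
    then have "s \<in> PiE D R" using s by (auto simp: PiE_iff)
    then obtain t where t: "t \<in> PiE D R" "\<forall>j\<in>insert i I. t j = s j" "t \<in> T"
      using * unfolding answers_def by blast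
    moreover have "t \<in> PiE D (R(i := {a}))" using t si by (auto simp: PiE_iff)
    ultimately show "\<exists>t\<in>PiE D (R(i := {a})). (\<forall>i\<in>I. t i = s i) \<and> t \<in> T" by blast
  qed
next
  assume *: "\<forall>a\<in>R i. answers D T I (R(i := {a}))"
  show "answers D T (insert i I) R" unfolding answers_def
  proof
    fix s assume s: "s \<in> PiE D R"
    then have "s i \<in> R i" using assms by auto
    moreover have "s \<in> PiE D (R(i := {s i}))" using s by (auto simp: PiE_iff)
    ultimately obtain t where t: "t \<in> PiE D (R(i := {s i}))" "\<forall>j\<in>I. t j = s j" "t \<in> T"
      using * unfolding answers_def by blast
    have ti: "t i = s i" using t(1) assms by (auto simp: PiE_iff)
    have "t j \<in> R j" if "j \<in> D" for j
      using t(1) that \<open>s i \<in> R i\<close> by (cases "j = i") (auto simp: PiE_iff)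
    then have "t \<in> PiE D R" using t by (auto simp: PiE_iff)
    then show "\<exists>t\<in>PiE D R. (\<forall>j\<in>insert i I. t j = s j) \<and> t \<in> T" using t ti by auto
  qed
qed

lemma finite_subcells:
  assumes "finite D" "\<And>i. i \<in> D \<Longrightarrow> finite (R i)"
  shows "finite (subcells D T I R)"
  unfolding subcells_def using assms
  by (intro finite_subset[OF _ finite_PiE[of D "\<lambda>i. Pow (R i) - {{}}"]]) auto

text \<open>The cells are sorted by their \<open>i\<close>-th factor \<open>X\<close>. It
  contributes its own sign, and what is left is a count of cells filling \<open>X\<close> in
  direction \<open>i\<close>.\<close>

lemma partial_euler_insert:
  assumes D: "finite D" "\<And>i. i \<in> D \<Longrightarrow> finite (R i)" and i: "i \<in> D" "i \<notin> I"
  shows "partial_euler D T I R =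
    (\<Sum>X\<in>Pow (R i) - {{}}. (- 1) ^ (card X - 1) * partial_euler D T (insert i I) (R(i := X)))"
proof -
  let ?sgn = "\<lambda>I S. \<Prod>j\<in>D - I. (- 1 :: int) ^ (card (S j) - 1)"
  have "partial_euler D T I R = (\<Sum>X\<in>Pow (R i) - {{}}. \<Sum>S\<in>{S \<in> subcells D T I R. S i = X}. ?sgn I S)"
    unfolding partial_euler_def using D i finite_subcells[OF D]
    by (subst sum.group) (auto simp: subcells_def PiE_iff)
  also have "\<dots> = (\<Sum>X\<in>Pow (R i) - {{}}. (- 1) ^ (card X - 1) * partial_euler D T (insert i I) (R(i := X)))"
  proof (rule sum.cong)
    fix X assume X: "X \<in> Pow (R i) - {{}}"
    have eq: "{S \<in> subcells D T I R. S i = X} = subcells D T (insert i I) (R(i := X))"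
    proof (intro subset_antisym subsetI)
      fix S assume "S \<in> {S \<in> subcells D T I R. S i = X}"
      then show "S \<in> subcells D T (insert i I) (R(i := X))"
        using i X by (auto simp: subcells_def PiE_iff)
    next
      fix S assume S: "S \<in> subcells D T (insert i I) (R(i := X))"
      then have SX: "S i = X" by (auto simp: subcells_def)
      have "S j \<in> Pow (R j) - {{}}" if "j \<in> D" for j
      proof -
        have "S j \<subseteq> (R(i := X)) j \<and> S j \<noteq> {}" using S that by (simp add: subcells_def PiE_iff)
        then show ?thesis using X by (cases "j = i") auto
      qed
      moreover have "S j = R j" if "j \<in> I" for j
        using S that i by (cases "j = i") (auto simp: subcells_def)
      ultimately show "S \<in> {S \<in> subcells D T I R. S i = X}"
        using S SX by (auto simp: subcells_def PiE_iff)
    qed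
    have "?sgn I S = (- 1) ^ (card X - 1) * ?sgn (insert i I) S" if "S i = X" for S
    proof -
      have "?sgn I S = (\<Prod>j\<in>insert i (D - insert i I). (- 1) ^ (card (S j) - 1))"
        using i by (intro prod.cong) auto
      also have "\<dots> = (- 1) ^ (card X - 1) * ?sgn (insert i I) S"
        using that D(1) by (subst prod.insert) auto
      finally show ?thesis .
    qed
    then have "(\<Sum>S\<in>{S \<in> subcells D T I R. S i = X}. ?sgn I S) =
        (\<Sum>S\<in>{S \<in> subcells D T I R. S i = X}. (- 1) ^ (card X - 1) * ?sgn (insert i I) S)"
      by (intro sum.cong) auto
    then show "(\<Sum>S\<in>{S \<in> subcells D T I R. S i = X}. ?sgn I S) =
        (- 1) ^ (card X - 1) * partial_euler D T (insert i I) (R(i := X))"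
      unfolding eq partial_euler_def sum_distrib_left .
  qed simp
  finally show ?thesis .
qed

text \<open>Induction on \<open>I\<close>, over all boxes at once. By induction, and for every
  \<open>X\<close>, the property \<open>answers\<close> with index set \<open>I\<close> in the box
  \<open>R(i := X)\<close> is a disjunction of \<open>h a\<close> over \<open>a\<close> in
  \<open>X\<close>. Inclusion-exclusion and uniqueness of Moebius inversion turn the disjunction
  into the conjunction of \<open>h a\<close>, which is \<open>answers\<close> with \<open>i\<close>
  added to \<open>I\<close>.\<close>

lemma partial_euler_eq:
  assumes D: "finite D" and A: "\<And>i. i \<in> D \<Longrightarrow> finite (A i)"
    and euler: "\<And>R. (\<And>i. i \<in> D \<Longrightarrow> R i \<noteq> {} \<and> R i \<subseteq> A i) \<Longrightarrow>
      partial_euler D T {} R = of_bool (PiE D R \<inter> T \<noteq> {})"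
    and I: "I \<subseteq> D" and R: "\<And>i. i \<in> D \<Longrightarrow> R i \<noteq> {} \<and> R i \<subseteq> A i"
  shows "partial_euler D T I R = of_bool (answers D T I R)"
proof -
  from I have "finite I" using D finite_subset by blast
  then show ?thesis using I R
  proof (induction I arbitrary: R rule: finite_induct)
    case empty
    have "answers D T {} R \<longleftrightarrow> PiE D R \<inter> T \<noteq> {}"
      using empty.prems(2) PiE_eq_empty_iff[of D R] unfolding answers_def by auto
    then show ?case using euler[of R] empty.prems(2) by simp
  next
    case (insert i I)
    have i: "i \<in> D" "i \<notin> I" and ID: "I \<subseteq> D" using insert by auto
    have fin: "finite (R j)" if "j \<in> D" for j using A insert.prems(2) that finite_subset by metis
    have ok: "(R(i := X)) j \<noteq> {} \<and> (R(i := X)) j \<subseteq> A j" if "X \<subseteq> R i" "X \<noteq> {}" "j \<in> D" for X j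
      using that insert.prems(2)[of j] by (cases "j = i") auto
    have IH: "partial_euler D T I (R(i := X)) = of_bool (answers D T I (R(i := X)))"
      if "X \<subseteq> R i" "X \<noteq> {}" for X
      using insert.IH[OF ID, of "R(i := X)"] ok[OF that] by blast
    \<comment> \<open>If \<open>answers\<close> holds, the induction hypothesis makes the partial
      Euler characteristic 1, hence non-zero, and \<open>forces\<close> follows. Thus the exchange
      of quantifiers for \<open>I\<close> is itself used to pass to
      \<open>insert i I\<close>.\<close>
    have eqv: "answers D T I (R(i := X)) \<longleftrightarrow> forces D T I (R(i := X))" if "X \<subseteq> R i" "X \<noteq> {}" for X
      using IH[OF that] partial_euler_nonzero_imp_forces[of D T I "R(i := X)"] forces_imp_answers ID
      by fastforce
    define h where "h a = answers D T I (R(i := {a}))" for a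
    have ex: "answers D T I (R(i := X)) \<longleftrightarrow> (\<exists>a\<in>X. h a)" if "X \<subseteq> R i" "X \<noteq> {}" for X
    proof -
      have "h a \<longleftrightarrow> forces D T I (R(i := {a}))" if "a \<in> X" for a
        using eqv[of "{a}"] that \<open>X \<subseteq> R i\<close> by (auto simp: h_def)
      then show ?thesis
        using eqv[OF that] forces_iff_singleton[OF i, of T "R(i := X)"] by simp
    qed
    \<comment> \<open>Writing the box as \<open>R(i := R i)\<close> exhibits the value as that of a
      function of the \<open>i\<close>-th factor, as \<open>sum_Pow_unique\<close> requires.\<close>
    have "partial_euler D T (insert i I) (R(i := R i)) = of_bool (\<forall>a\<in>R i. h a)"
    proof (rule sum_Pow_unique[of "R i" "\<lambda>X. partial_euler D T (insert i I) (R(i := X))"])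
      fix Y assume Y: "Y \<subseteq> R i" "Y \<noteq> {}"
      have finY: "finite ((R(i := Y)) j)" if "j \<in> D" for j
        using fin[OF that] Y finite_subset by (cases "j = i") auto
      have "(\<Sum>Z\<in>Pow Y - {{}}. (- 1) ^ (card Z - 1) * partial_euler D T (insert i I) (R(i := Z))) =
          partial_euler D T I (R(i := Y))"
        using partial_euler_insert[OF D, of "R(i := Y)" i I T] finY i by simp
      also have "\<dots> = of_bool (\<exists>a\<in>Y. h a)" using IH[OF Y] ex[OF Y] by simp
      also have "\<dots> = (\<Sum>Z\<in>Pow Y - {{}}. (- 1) ^ (card Z - 1) * of_bool (\<forall>a\<in>Z. h a))"
        using finY[OF i(1)] by (intro sum_Pow_all_eq_ex[symmetric]) simp
      finally show "(\<Sum>Z\<in>Pow Y - {{}}. (- 1) ^ (card Z - 1) * partial_euler D T (insert i I) (R(i := Z))) = \<dots>" .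
    qed (use fin i insert.prems in auto)
    then show ?case using answers_insert_iff[OF i(1), of T I R] by (simp add: h_def)
  qed
qed

section \<open>The exchange property\<close>

text \<open>From here on this is all that is kept of acyclicity, and the field no longer occurs in
  it. The reverse implication is \<open>forces_imp_answers\<close>.\<close>

definition exchange :: "nat set \<Rightarrow> (nat \<Rightarrow> 'a set) \<Rightarrow> (nat \<Rightarrow> 'a) set \<Rightarrow> bool" where
  "exchange D A T \<longleftrightarrow> (\<forall>I\<subseteq>D. \<forall>R. (\<forall>i\<in>D. R i \<noteq> {} \<and> R i \<subseteq> A i) \<longrightarrow> answers D T I R \<longrightarrow> forces D T I R)"

lemma exchangeD:
  assumes "exchange D A T" "I \<subseteq> D" "\<And>i. i \<in> D \<Longrightarrow> R i \<noteq> {} \<and> R i \<subseteq> A i"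
    and "\<And>s. s \<in> PiE D R \<Longrightarrow> \<exists>t\<in>PiE D R. (\<forall>i\<in>I. t i = s i) \<and> t \<in> T"
  shows "forces D T I R"
proof (rule assms(1)[unfolded exchange_def, rule_format])
  show "answers D T I R" unfolding answers_def using assms(4) by (rule ballI)
qed (use assms(2,3) in auto)

text \<open>Acyclicity of \<open>T\<close> in each box supplies the Euler characteristics assumed in
  \<open>partial_euler_eq\<close>. When \<open>answers\<close> holds, the partial Euler
  characteristic is 1, so a suitable cell exists.\<close>

lemma acyclic_subset_exchange:
  assumes A: "\<And>i. i \<in> {1..n} \<Longrightarrow> finite (A i)"
    and acyclic: "acyclic_subset TYPE('k::field) n A T"
  shows "exchange {1..n} A T"
  unfolding exchange_def
proof (intro allI impI)
  fix I R assume I: "I \<subseteq> {1..n}" and R: "\<forall>i\<in>{1..n}. R i \<noteq> {} \<and> R i \<subseteq> A i"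
    and ans: "answers {1..n} T I R"
  have euler: "partial_euler {1..n} T {} R = of_bool (PiE {1..n} R \<inter> T \<noteq> {})"
    if R: "\<And>i. i \<in> {1..n} \<Longrightarrow> R i \<noteq> {} \<and> R i \<subseteq> A i" for R
  proof -
    define T' where "T' = T \<inter> PiE {1..n} R"
    \<comment> \<open>A non-empty product lies in another product only if each factor does. Hence
      the cells of \<open>T'\<close> are exactly the cells of \<open>T\<close> with all factors
      inside those of \<open>R\<close>.\<close>
    have sub: "S i \<subseteq> R i" if S: "S \<in> cells n A T'" and i: "i \<in> {1..n}" for S i
    proof -
      have "PiE {1..n} S \<subseteq> PiE {1..n} R" using S by (auto simp: cells_def T'_def)
      moreover have "PiE {1..n} S \<noteq> {}" using S unfolding PiE_eq_empty_iff by (auto simp: cells_def PiE_iff)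
      ultimately show ?thesis using i unfolding subset_PiE by blast
    qed
    have T': "PiE {1..n} S \<subseteq> T'" if "S \<in> subcells {1..n} T {} R" for S
      using that PiE_mono[of "{1..n}" S R] by (auto simp: subcells_def T'_def PiE_iff)
    have cells: "cells n A T' = subcells {1..n} T {} R"
    proof (intro subset_antisym subsetI)
      fix S assume S: "S \<in> cells n A T'"
      then have "PiE {1..n} S \<subseteq> T" unfolding cells_def T'_def by blast
      moreover have "S \<in> PiE {1..n} (\<lambda>i. Pow (R i) - {{}})"
        using S sub[OF S] by (simp add: cells_def PiE_iff)
      ultimately show "S \<in> subcells {1..n} T {} R" by (simp add: subcells_def)
    next
      fix S assume S: "S \<in> subcells {1..n} T {} R"
      have "S i \<in> Pow (A i) - {{}}" if "i \<in> {1..n}" for i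
      proof -
        have "S i \<in> Pow (R i) - {{}}" using S that by (auto simp: subcells_def)
        then show ?thesis using R[OF that] by auto
      qed
      moreover have "S \<in> extensional {1..n}" using S by (simp add: subcells_def PiE_iff)
      ultimately show "S \<in> cells n A T'" using T'[OF S] by (simp add: cells_def PiE_iff)
    qed
    have "partial_euler {1..n} T {} R = (\<Sum>S\<in>cells n A T'. (- 1) ^ cell_dim n S)"
      unfolding partial_euler_def cells by (simp add: cell_dim_def power_sum)
    also have "\<dots> = (if cells n A T' = {} then 0 else 1)"
      using acyclic R by (intro euler_characteristic_cells[where 'k='k] A)
        (auto simp: acyclic_subset_def T'_def)
    also have "cells n A T' = {} \<longleftrightarrow> T' = {}"
    proof
      assume empty: "cells n A T' = {}"
      show "T' = {}"
      proof (rule ccontr)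
        assume "T' \<noteq> {}"
        then obtain t where t: "t \<in> T" "t \<in> PiE {1..n} R" by (auto simp: T'_def)
        define S where "S = (\<lambda>i\<in>{1..n}. {t i})"
        have "PiE {1..n} S = {t}"
        proof -
          have "PiE {1..n} S = {restrict t {1..n}}" unfolding PiE_eq_singleton by (simp add: S_def)
          then show ?thesis using t(2) by simp
        qed
        moreover have "S i \<in> Pow (A i) - {{}}" if "i \<in> {1..n}" for i
          using R[OF that] PiE_mem[OF t(2) that] that by (auto simp: S_def)
        ultimately have "S \<in> cells n A T'"
          using t by (simp add: cells_def T'_def S_def PiE_iff)
        then show False using empty by simp
      qed
    next
      assume "T' = {}"
      then show "cells n A T' = {}" by (auto simp: cells_def PiE_iff PiE_eq_empty_iff)
    qed
    finally show ?thesis by (simp add: T'_def Int_commute)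
  qed
  have "partial_euler {1..n} T I R = of_bool (answers {1..n} T I R)"
    by (rule partial_euler_eq[where A = A, OF _ A euler I]) (use R in auto)
  then have "partial_euler {1..n} T I R = 1" using ans by simp
  then show "forces {1..n} T I R" by (intro partial_euler_nonzero_imp_forces) simp
qed

section \<open>Cells of prescribed sizes\<close>

text \<open>A set that is not exhausted by deleting any \<open>u i\<close> points has at least
  \<open>u i + 1\<close> of them; this is the source of the sizes. The factors in \<open>L\<close>
  are treated one at a time. Those in \<open>W\<close> already carry a universal choice, and the
  induction varies \<open>W\<close> and \<open>B\<close> because a finished factor is moved into
  \<open>W\<close> with its box shrunk.\<close>

lemma exchange_subcell:
  fixes A :: "nat \<Rightarrow> 'a set" and u :: "nat \<Rightarrow> nat"
  assumes exch: "exchange D A T" and A: "\<And>i. i \<in> D \<Longrightarrow> finite (A i)"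
    and "finite L" "L \<subseteq> D" "W \<subseteq> D" "W \<inter> L = {}" "\<And>i. i \<in> D \<Longrightarrow> B i \<subseteq> A i"
    and "\<And>F :: nat \<Rightarrow> 'a set. (\<And>i. i \<in> L \<Longrightarrow> finite (F i) \<and> card (F i) \<le> u i) \<Longrightarrow>
      forces D T W (\<lambda>i. if i \<in> L then B i - F i else B i)"
  shows "\<exists>R. (\<forall>i\<in>L. R i \<subseteq> B i \<and> card (R i) = Suc (u i)) \<and> (\<forall>i. i \<notin> L \<longrightarrow> R i = B i) \<and>
    forces D T (W \<union> L) R"
  using assms(3-)
proof (induction L arbitrary: W B rule: finite_induct)
  case empty
  from empty.prems(5)[of "\<lambda>_. {}"] have "forces D T W B" by simp
  then show ?case by auto
next
  case (insert i L)
  have i: "i \<in> D" "i \<notin> L" "i \<notin> W" and L: "L \<subseteq> D" and W: "W \<subseteq> D" "W \<inter> L = {}"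
    using insert.prems insert.hyps by auto
  define good where "good x R \<longleftrightarrow> (\<forall>l\<in>L. R l \<subseteq> B l \<and> card (R l) = Suc (u l)) \<and>
    (\<forall>j. j \<notin> L \<longrightarrow> j \<noteq> i \<longrightarrow> R j = B j) \<and> R i = {x} \<and> forces D T (W \<union> L) R" for x R
  define P where "P = {x \<in> B i. \<exists>R. good x R}"
  \<comment> \<open>The \<open>R\<close> in \<open>good x R\<close> depends on \<open>x\<close>. It only serves to show that \<open>P\<close> is large; exchange at \<open>i\<close>
    then allows a second use of the induction hypothesis, which gives one \<open>R\<close> for all \<open>x\<close>.\<close>
  have avoid: "\<exists>x\<in>B i - X. x \<in> P" if X: "finite X" "card X \<le> u i" for X
  proof -
    define B' where "B' = B(i := B i - X)"
    \<comment> \<open>Spending the allowed deletions in direction \<open>i\<close> on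
      \<open>X\<close> leaves the hypothesis intact for \<open>L\<close> in a smaller box.\<close>
    have "\<exists>R. (\<forall>l\<in>L. R l \<subseteq> B' l \<and> card (R l) = Suc (u l)) \<and> (\<forall>l. l \<notin> L \<longrightarrow> R l = B' l) \<and>
        forces D T (W \<union> L) R"
    proof (rule insert.IH[OF L W])
      show "B' j \<subseteq> A j" if "j \<in> D" for j using insert.prems(4)[OF that] by (auto simp: B'_def)
      fix F :: "nat \<Rightarrow> 'a set" assume F: "\<And>l. l \<in> L \<Longrightarrow> finite (F l) \<and> card (F l) \<le> u l"
      have "forces D T W (\<lambda>j. if j \<in> insert i L then B j - (F(i := X)) j else B j)"
        by (rule insert.prems(5)) (use F X i in auto)
      moreover have "(\<lambda>j. if j \<in> insert i L then B j - (F(i := X)) j else B j) =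
          (\<lambda>j. if j \<in> L then B' j - F j else B' j)"
        using i by (auto simp: B'_def fun_eq_iff)
      ultimately show "forces D T W (\<lambda>j. if j \<in> L then B' j - F j else B' j)" by simp
    qed
    then obtain R where R: "\<And>l. l \<in> L \<Longrightarrow> R l \<subseteq> B' l \<and> card (R l) = Suc (u l)"
      "\<And>l. l \<notin> L \<Longrightarrow> R l = B' l" "forces D T (W \<union> L) R" by blast
    have "i \<notin> W \<union> L" using i by simp
    from iffD1[OF forces_iff_singleton[OF i(1) this] R(3)]
    obtain x where x: "x \<in> R i" "forces D T (W \<union> L) (R(i := {x}))" ..
    have Ri: "R i = B i - X" using R(2)[OF i(2)] by (simp add: B'_def)
    have "good x (R(i := {x}))"
      unfolding good_def
    proof (intro conjI ballI allI impI)
      fix l assume "l \<in> L"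
      moreover have "l \<noteq> i" using \<open>l \<in> L\<close> i by auto
      ultimately show "(R(i := {x})) l \<subseteq> B l" "card ((R(i := {x})) l) = Suc (u l)"
        using R(1)[of l] by (auto simp: B'_def)
    next
      fix j assume "j \<notin> L" "j \<noteq> i"
      then show "(R(i := {x})) j = B j" using R(2)[of j] by (simp add: B'_def)
    qed (use x in auto)
    then show ?thesis using x(1) Ri by (auto simp: P_def)
  qed
  have finP: "finite P"
    using insert.prems(4)[OF i(1)] A[OF i(1)] finite_subset unfolding P_def by (metis (no_types, lifting) mem_Collect_eq subsetI)
  \<comment> \<open>If \<open>P\<close> had at most \<open>u i\<close> points, it could itself be
    deleted, and yet a point of \<open>P\<close> would survive.\<close>
  then have "Suc (u i) \<le> card P" using avoid[of P] by (meson DiffE not_less_eq_eq)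
  then obtain Ri where Ri: "Ri \<subseteq> P" "card Ri = Suc (u i)" "finite Ri"
    by (rule obtain_subset_with_card_n)
  have RiB: "Ri \<subseteq> B i" using Ri by (auto simp: P_def)
  define B' where "B' = B(i := Ri)"
  have "\<exists>R. (\<forall>l\<in>L. R l \<subseteq> B' l \<and> card (R l) = Suc (u l)) \<and> (\<forall>l. l \<notin> L \<longrightarrow> R l = B' l) \<and>
      forces D T (insert i W \<union> L) R"
  proof (rule insert.IH[OF L])
    show "insert i W \<subseteq> D" "insert i W \<inter> L = {}" using i W by auto
    show B'A: "B' j \<subseteq> A j" if "j \<in> D" for j
      using insert.prems(4)[OF that] RiB by (cases "j = i") (auto simp: B'_def)
    fix F :: "nat \<Rightarrow> 'a set" assume F: "\<And>l. l \<in> L \<Longrightarrow> finite (F l) \<and> card (F l) \<le> u l"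
    let ?B = "\<lambda>j. if j \<in> L then B' j - F j else B' j"
    have Bi: "?B i = Ri" using i by (simp add: B'_def)
    \<comment> \<open>The value \<open>x\<close> comes with its own box \<open>R\<close>, which has
      \<open>u l + 1\<close> points in each direction \<open>l\<close> of \<open>L\<close>, so one
      of them survives the deletion of \<open>F l\<close>. The point \<open>t\<close> uses these
      survivors on \<open>L\<close>, the given \<open>s\<close> on \<open>W\<close>, and the witness
      \<open>t0\<close> elsewhere; \<open>t0\<close> already equals \<open>x\<close> at
      \<open>i\<close>.\<close>
    have answer: "\<exists>t\<in>PiE D ?B. (\<forall>j\<in>W. t j = s j) \<and> t i = x \<and> t \<in> T"
      if x: "x \<in> Ri" and s: "\<And>j. j \<in> W \<Longrightarrow> s j \<in> B j" for x s
    proof -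
      obtain R where R: "good x R" using x Ri(1) by (auto simp: P_def)
      then have R': "\<And>l. l \<in> L \<Longrightarrow> R l \<subseteq> B l \<and> card (R l) = Suc (u l)"
        "\<And>j. j \<notin> L \<Longrightarrow> j \<noteq> i \<Longrightarrow> R j = B j" "R i = {x}" by (auto simp: good_def)
      obtain t0 where t0: "t0 \<in> PiE D R"
        "\<And>s. s \<in> PiE D R \<Longrightarrow> (\<forall>i\<in>D - (W \<union> L). s i = t0 i) \<Longrightarrow> s \<in> T"
        using R unfolding good_def forces_def by blast
      have ne: "R l - F l \<noteq> {}" if "l \<in> L" for l
      proof
        assume "R l - F l = {}"
        then have "card (R l) \<le> card (F l)" using F[OF that] by (intro card_mono) auto
        then show False using R'(1)[OF that] F[OF that] by simp
      qed
      define t where "t = (\<lambda>j\<in>D. if j \<in> L then SOME a. a \<in> R j - F j else if j \<in> W then s j else t0 j)"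
      have tL: "t l \<in> R l - F l" if "l \<in> L" for l
      proof -
        have "t l = (SOME a. a \<in> R l - F l)" using that L by (simp add: t_def subset_iff)
        then show ?thesis using ne[OF that] by (metis some_in_eq)
      qed
      have tW: "t j = s j" if "j \<in> W" for j using that W by (auto simp: t_def)
      have tO: "t j = t0 j" if "j \<in> D - (W \<union> L)" for j using that by (auto simp: t_def)
      have t_ext: "t \<in> extensional D" by (simp add: t_def)
      have tR: "t j \<in> R j" if "j \<in> D" for j
      proof -
        consider "j \<in> L" | "j \<in> W" | "j \<in> D - (W \<union> L)" using \<open>j \<in> D\<close> by blast
        then show ?thesis
        proof cases
          case 1 then show ?thesis using tL by blast
        next
          case 2
          then have "j \<notin> L" "j \<noteq> i" using W i by auto
          then show ?thesis using 2 tW s R'(2) by auto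
        next
          case 3 then show ?thesis using tO t0(1) by (auto simp: PiE_iff)
        qed
      qed
      then have "t \<in> PiE D R" using t_ext by (simp add: PiE_iff)
      then have "t \<in> T" using t0(2) tO by blast
      moreover have ti: "t i = x" using tR[OF i(1)] R'(3) by simp
      moreover have "t j \<in> ?B j" if "j \<in> D" for j
      proof -
        consider "j \<in> L" | "j = i" | "j \<notin> L" "j \<noteq> i" by blast
        then show ?thesis
        proof cases
          case 1
          then have "j \<noteq> i" using i by auto
          then show ?thesis using 1 tL[OF 1] R'(1)[OF 1] by (auto simp: B'_def)
        next
          case 2 then show ?thesis using Bi ti x by metis
        next
          case 3 then show ?thesis using tR[OF that] R'(2) by (simp add: B'_def)
        qed
      qed
      then have "t \<in> PiE D ?B" using t_ext by (simp add: PiE_iff)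
      ultimately show ?thesis using tW by blast
    qed
    show "forces D T (insert i W) ?B"
    proof (rule exchangeD[OF exch])
      show "insert i W \<subseteq> D" using i W by simp
      \<comment> \<open>Exchange asks for a non-empty box. A point of it is obtained from
        \<open>answer\<close>, with values on \<open>W\<close> borrowed from the witness of some
        good box.\<close>
      obtain x where x: "x \<in> Ri" using Ri(2) by (metis card.empty equals0I nat.simps(3))
      have "\<exists>t\<in>PiE D ?B. (\<forall>j\<in>W. t j = t1 j) \<and> t i = x \<and> t \<in> T"
        if "\<forall>j\<in>W. t1 j \<in> B j" for t1 using answer[OF x] that by blast
      moreover obtain t1 where "\<forall>j\<in>W. t1 j \<in> B j"
      proof -
        obtain R where R: "good x R" using x Ri(1) by (auto simp: P_def)
        then obtain t0 where "t0 \<in> PiE D R" unfolding good_def forces_def by blast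
        moreover have "R j = B j" if "j \<in> W" for j
          using R that W i by (auto simp: good_def)
        ultimately have "\<forall>j\<in>W. t0 j \<in> B j" using W(1) by (metis PiE_mem subsetD)
        then show ?thesis by (rule that)
      qed
      ultimately obtain t where t: "t \<in> PiE D ?B" by blast
      fix j assume "j \<in> D"
      then have "t j \<in> ?B j" using t by (rule PiE_mem[rotated])
      then show "?B j \<noteq> {} \<and> ?B j \<subseteq> A j" using B'A[OF \<open>j \<in> D\<close>] by auto
    next
      fix s assume s: "s \<in> PiE D ?B"
      have "s i \<in> Ri" using PiE_mem[OF s i(1)] Bi by simp
      moreover have "s j \<in> B j" if "j \<in> W" for j
        using PiE_mem[OF s, of j] that W i by (auto simp: B'_def split: if_splits)
      ultimately show "\<exists>t\<in>PiE D ?B. (\<forall>j\<in>insert i W. t j = s j) \<and> t \<in> T"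
        using answer[of "s i" s] by auto
    qed
  qed
  then obtain R where R: "\<And>l. l \<in> L \<Longrightarrow> R l \<subseteq> B' l \<and> card (R l) = Suc (u l)"
    "\<And>l. l \<notin> L \<Longrightarrow> R l = B' l" "forces D T (insert i W \<union> L) R" by blast
  have "R l \<subseteq> B l \<and> card (R l) = Suc (u l)" if l: "l \<in> insert i L" for l
  proof (cases "l = i")
    case True
    then show ?thesis using R(2)[OF i(2)] RiB Ri(2) by (simp add: B'_def)
  next
    case False
    then show ?thesis using R(1)[of l] l by (auto simp: B'_def)
  qed
  moreover have "R l = B l" if "l \<notin> insert i L" for l using R(2)[of l] that by (simp add: B'_def)
  moreover have "insert i W \<union> L = W \<union> insert i L" by simp
  ultimately show ?case using R(3) by metis
qed

lemma forces_all_imp_subset: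
  assumes "forces D T D R"
  shows "PiE D R \<subseteq> T"
  using assms unfolding forces_def by auto

text \<open>The case \<open>W = {}\<close>, \<open>L = D\<close> of \<open>exchange_subcell\<close>.
  With no universal directions \<open>forces\<close> says that the box meets \<open>T\<close>; with
  all directions universal it says, through \<open>forces_all_imp_subset\<close>, that the box lies
  in \<open>T\<close>.\<close>

lemma cell_of_size:
  fixes A :: "nat \<Rightarrow> 'a set" and u :: "nat \<Rightarrow> nat"
  assumes exch: "exchange D A T" and A: "finite D" "\<And>i. i \<in> D \<Longrightarrow> finite (A i)"
    and avoid: "\<And>F :: nat \<Rightarrow> 'a set. (\<And>i. i \<in> D \<Longrightarrow> finite (F i) \<and> card (F i) \<le> u i) \<Longrightarrow>
      \<exists>t\<in>T \<inter> PiE D A. \<forall>i\<in>D. t i \<notin> F i"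
  shows "\<exists>R. (\<forall>i\<in>D. R i \<subseteq> A i \<and> card (R i) = Suc (u i)) \<and> PiE D R \<subseteq> T"
proof -
  have "\<exists>R. (\<forall>i\<in>D. R i \<subseteq> A i \<and> card (R i) = Suc (u i)) \<and> (\<forall>i. i \<notin> D \<longrightarrow> R i = A i) \<and>
    forces D T ({} \<union> D) R"
  proof (rule exchange_subcell[OF exch A(2) A(1)])
    fix F :: "nat \<Rightarrow> 'a set" assume "\<And>i. i \<in> D \<Longrightarrow> finite (F i) \<and> card (F i) \<le> u i"
    then obtain t where t: "t \<in> T" "t \<in> PiE D A" "\<forall>i\<in>D. t i \<notin> F i" using avoid[of F] by blast
    let ?B = "\<lambda>i. if i \<in> D then A i - F i else A i"
    have "t \<in> PiE D ?B" using t by (auto simp: PiE_iff)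
    moreover have "s = t" if "s \<in> PiE D ?B" "\<forall>i\<in>D - {}. s i = t i" for s
      by (rule PiE_ext[OF that(1) \<open>t \<in> PiE D ?B\<close>]) (use that in auto)
    ultimately show "forces D T {} ?B" using t(1) unfolding forces_def by blast
  qed auto
  then show ?thesis using forces_all_imp_subset[of D T] by auto
qed

text \<open>Induction on the set \<open>E\<close> of factors in which \<open>Q\<close> may differ
  from \<open>R\<close>. A difference at \<open>i\<close> yields a cell \<open>R'\<close> whose
  \<open>i\<close>-th factor is \<open>R i\<close> with one extra point. Cut back to
  \<open>R i\<close> there, \<open>R'\<close> differs from \<open>R\<close> only inside
  \<open>E - {i}\<close>, so it equals \<open>R\<close> by induction and \<open>R'\<close> is a
  forbidden enlargement. Maximality is assumed only for one-point enlargements in \<open>E\<close>,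
  a form that is inherited by smaller sets.\<close>

lemma maximal_cell_unique_of_size:
  fixes A :: "nat \<Rightarrow> 'a set"
  assumes exch: "exchange D A T" and A: "finite D" "\<And>i. i \<in> D \<Longrightarrow> finite (A i)"
    and R: "PiE D R \<subseteq> T" "\<And>i. i \<in> D \<Longrightarrow> R i \<noteq> {} \<and> R i \<subseteq> A i"
    and "finite E" "E \<subseteq> D" "PiE D Q \<subseteq> T" "\<And>i. i \<in> D \<Longrightarrow> Q i \<subseteq> A i"
      "\<And>i. i \<in> E \<Longrightarrow> card (Q i) = card (R i)" "\<And>i. i \<in> D - E \<Longrightarrow> Q i = R i"
      "\<And>i a. i \<in> E \<Longrightarrow> a \<in> A i - R i \<Longrightarrow> \<not> PiE D (R(i := insert a (R i))) \<subseteq> T"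
    and "i \<in> D"
  shows "Q i = R i"
  using assms(6-)
proof (induction E arbitrary: Q i rule: finite_psubset_induct)
  case (psubset E)
  note Qsub = psubset.prems(2) and QA = psubset.prems(3) and Qcard = psubset.prems(4)
    and QR = psubset.prems(5) and max = psubset.prems(6)
  show ?case
  proof (rule ccontr)
    assume "Q i \<noteq> R i"
    with psubset.prems(7) QR have iE: "i \<in> E" by blast
    then have iD: "i \<in> D" using psubset.prems(1) by blast
    have fin: "finite (R j)" "finite (Q j)" if "j \<in> D" for j
      using R(2) A(2) QA that finite_subset by metis+
    have "\<not> Q i \<subseteq> R i"
      using card_subset_eq[OF fin(1)[OF iD]] Qcard[OF iE] \<open>Q i \<noteq> R i\<close> by blast
    then obtain a where a: "a \<in> Q i" "a \<notin> R i" by blast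
    define L where "L = E - {i}"
    \<comment> \<open>On \<open>L\<close> the whole of \<open>A j\<close> is allowed, so that points
      of both \<open>Q\<close> and \<open>R\<close> fit into the box; at \<open>i\<close> one point
      of \<open>Q\<close> is added to \<open>R i\<close>.\<close>
    define B where "B j = (if j \<in> L then A j else if j = i then insert a (R i) else R j)" for j
    \<comment> \<open>This is the largest number of deletions that cannot exhaust a set of the size
      of \<open>R j\<close>.\<close>
    define u where "u j = card (R j) - 1" for j
    have L: "finite L" "L \<subseteq> D" "i \<notin> L" using psubset.hyps psubset.prems(1) by (auto simp: L_def)
    have cardR: "card (R j) = Suc (u j)" if "j \<in> D" for j
      using fin(1)[OF that] R(2)[OF that] by (simp add: u_def card_gt_0_iff)
    have BA: "B j \<subseteq> A j" if "j \<in> D" for j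
      using R(2)[OF that] QA[OF that] a(1) by (auto simp: B_def)
    have "\<exists>R'. (\<forall>j\<in>L. R' j \<subseteq> B j \<and> card (R' j) = Suc (u j)) \<and> (\<forall>j. j \<notin> L \<longrightarrow> R' j = B j) \<and>
        forces D T ((D - L) \<union> L) R'"
    proof (rule exchange_subcell[OF exch A(2) L(1,2) _ _ BA])
      fix F :: "nat \<Rightarrow> 'a set" assume F: "\<And>j. j \<in> L \<Longrightarrow> finite (F j) \<and> card (F j) \<le> u j"
      let ?B = "\<lambda>j. if j \<in> L then B j - F j else B j"
      have ne: "X - F j \<noteq> {}" if "j \<in> L" "card X = Suc (u j)" for j X
      proof
        assume "X - F j = {}"
        then have "card X \<le> card (F j)" using F[OF that(1)] by (intro card_mono) auto
        then show False using that F[OF that(1)] by simp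
      qed
      \<comment> \<open>The cell \<open>C\<close> will be \<open>Q\<close> when
        \<open>s i = a\<close> and \<open>R\<close> otherwise. Both contain the prescribed
        coordinates off \<open>L\<close>, and on \<open>L\<close> both have factors large enough to
        survive the deletions.\<close>
      have answer: "\<exists>t\<in>PiE D ?B. (\<forall>j\<in>D - L. t j = s j) \<and> t \<in> T"
        if C: "PiE D C \<subseteq> T" "\<And>j. j \<in> L \<Longrightarrow> C j \<subseteq> A j \<and> card (C j) = Suc (u j)"
          and s: "\<And>j. j \<in> D - L \<Longrightarrow> s j \<in> C j \<inter> B j" for C s
      proof -
        define t where "t = (\<lambda>j\<in>D. if j \<in> L then SOME x. x \<in> C j - F j else s j)"
        have tL: "t j \<in> C j - F j" if "j \<in> L" for j
        proof -
          have "t j = (SOME x. x \<in> C j - F j)" using that L(2) by (simp add: t_def subset_iff)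
          then show ?thesis using ne[OF that, of "C j"] C(2)[OF that] by (metis some_in_eq)
        qed
        have tO: "t j = s j" if "j \<in> D - L" for j using that by (auto simp: t_def)
        have ext: "t \<in> extensional D" by (simp add: t_def)
        have "t j \<in> C j" if "j \<in> D" for j using tL[of j] tO[of j] s[of j] that by (cases "j \<in> L") auto
        then have "t \<in> PiE D C" using ext by (simp add: PiE_iff)
        then have "t \<in> T" using C(1) by blast
        moreover have "t j \<in> ?B j" if "j \<in> D" for j
          using tL[of j] tO[of j] s[of j] C(2)[of j] that by (cases "j \<in> L") (auto simp: B_def)
        then have "t \<in> PiE D ?B" using ext by (simp add: PiE_iff)
        ultimately show ?thesis using tO by blast
      qed
      show "forces D T (D - L) ?B"
      proof (rule exchangeD[OF exch])
        fix j assume j: "j \<in> D"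
        show "?B j \<noteq> {} \<and> ?B j \<subseteq> A j"
        proof (cases "j \<in> L")
          case True
          then have "R j - F j \<noteq> {}" using ne cardR[OF j] by blast
          then show ?thesis using True R(2)[OF j] by (auto simp: B_def)
        next
          case False
          then show ?thesis using R(2)[OF j] BA[OF j] by (auto simp: B_def)
        qed
      next
        fix s assume s: "s \<in> PiE D ?B"
        have sB: "s j \<in> B j" if "j \<in> D - L" for j using PiE_mem[OF s, of j] that by simp
        have sR: "s j \<in> R j" if "j \<in> D - L" "j \<noteq> i" for j using sB[of j] that by (simp add: B_def)
        show "\<exists>t\<in>PiE D ?B. (\<forall>j\<in>D - L. t j = s j) \<and> t \<in> T"
        proof (cases "s i = a")
          case True
          show ?thesis
          proof (rule answer[OF Qsub])
            show "Q j \<subseteq> A j \<and> card (Q j) = Suc (u j)" if "j \<in> L" for j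
              using that QA[of j] Qcard[of j] cardR[of j] L(2) by (auto simp: L_def)
            fix j assume j: "j \<in> D - L"
            show "s j \<in> Q j \<inter> B j"
            proof (cases "j = i")
              case False
              then have "j \<in> D - E" using j by (auto simp: L_def)
              then show ?thesis using QR[of j] sR[OF j False] sB[OF j] by simp
            qed (use True a sB[OF j] in auto)
          qed
        next
          case False
          show ?thesis
          proof (rule answer[OF R(1)])
            show "R j \<subseteq> A j \<and> card (R j) = Suc (u j)" if "j \<in> L" for j
              using that R(2)[of j] cardR[of j] L(2) by auto
            fix j assume j: "j \<in> D - L"
            show "s j \<in> R j \<inter> B j"
              using sB[OF j] sR[OF j] False L(3) by (cases "j = i") (auto simp: B_def)
          qed
        qed
      qed simp
    qed auto
    moreover have "(D - L) \<union> L = D" using L(2) by auto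
    ultimately obtain R' where R': "\<And>j. j \<in> L \<Longrightarrow> R' j \<subseteq> B j \<and> card (R' j) = Suc (u j)"
      "\<And>j. j \<notin> L \<Longrightarrow> R' j = B j" "forces D T D R'" by metis
    have R'T: "PiE D R' \<subseteq> T" using R'(3) by (rule forces_all_imp_subset)
    have R'i: "R' i = insert a (R i)" using R'(2)[OF L(3)] L(3) by (simp add: B_def)
    have R'O: "R' j = R j" if "j \<in> D - E" for j
      using R'(2)[of j] that iE by (auto simp: B_def L_def)
    \<comment> \<open>The induction hypothesis for \<open>L\<close> is applied to \<open>R'\<close>
      with the extra point \<open>a\<close> removed.\<close>
    have "(R'(i := R i)) j = R j" if "j \<in> D" for j
    proof (rule psubset.IH[of L])
      show "L \<subset> E" using iE by (auto simp: L_def)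
      have "PiE D (R'(i := R i)) \<subseteq> PiE D R'" using R'i by (intro PiE_mono) auto
      then show "PiE D (R'(i := R i)) \<subseteq> T" using R'T by blast
      show "(R'(i := R i)) j \<subseteq> A j" if "j \<in> D" for j
        using R'(1)[of j] R'(2)[of j] BA[OF that] R(2)[OF that] by (cases "j \<in> L") auto
      show "card ((R'(i := R i)) j) = card (R j)" if "j \<in> L" for j
        using that R'(1)[of j] cardR[of j] L by auto
      show "(R'(i := R i)) j = R j" if "j \<in> D - L" for j
        using that R'O[of j] by (auto simp: L_def)
      show "\<not> PiE D (R(j := insert b (R j))) \<subseteq> T" if "j \<in> L" "b \<in> A j - R j" for j b
        by (rule max) (use that in \<open>auto simp: L_def\<close>)
    qed (use L that in auto)
    then have "PiE D R' = PiE D (R(i := insert a (R i)))"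
      using R'i by (intro PiE_cong) (metis fun_upd_other fun_upd_same)
    moreover have "a \<in> A i - R i" using a QA[OF iD] by blast
    ultimately show False using max[OF iE] R'T by metis
  qed
qed

section \<open>Monomial ideals\<close>

lemma keys_add_nat: "Poly_Mapping.keys (u + v :: 'v \<Rightarrow>\<^sub>0 nat) = Poly_Mapping.keys u \<union> Poly_Mapping.keys v"
  by (auto simp: in_keys_iff lookup_add)

lemma pvar_power: "pvar v ^ e = (Poly_Mapping.single (Poly_Mapping.single v e) 1 :: ('v, 'k::field) mpoly)"
  by (induction e) (simp_all add: pvar_def mult_single flip: single_add)

lemma prod_single_one:
  "(\<Prod>i\<in>I. Poly_Mapping.single (f i) 1) = (Poly_Mapping.single (\<Sum>i\<in>I. f i) 1 :: ('v, 'k::field) mpoly)"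
  by (induction I rule: infinite_finite_induct) (simp_all add: mult_single)

lemma single_dvd_single:
  assumes "Poly_Mapping.single w 1 dvd (Poly_Mapping.single u 1 :: ('v, 'k::field) mpoly)"
  shows "\<exists>v. u = w + v"
proof -
  obtain q where "(Poly_Mapping.single u 1 :: ('v, 'k) mpoly) = Poly_Mapping.single w 1 * q"
    using assms by (elim dvdE)
  moreover have "u \<in> Poly_Mapping.keys (Poly_Mapping.single u 1 :: ('v, 'k) mpoly)" by simp
  ultimately have "u \<in> Poly_Mapping.keys ((Poly_Mapping.single w 1 :: ('v, 'k) mpoly) * q)" by metis
  then show ?thesis using keys_mult[of "Poly_Mapping.single w (1 :: 'k)" q] by auto
qed

lemma pvar_dvd_single:
  assumes "a \<in> Poly_Mapping.keys u"
  shows "pvar a dvd (Poly_Mapping.single u 1 :: ('v, 'k::field) mpoly)"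
proof -
  have "u = Poly_Mapping.single a 1 + (u - Poly_Mapping.single a 1)"
    using assms by (intro poly_mapping_eqI) (auto simp: lookup_add lookup_minus lookup_single in_keys_iff when_def)
  then have "(Poly_Mapping.single u 1 :: ('v, 'k) mpoly) =
      pvar a * Poly_Mapping.single (u - Poly_Mapping.single a 1) 1"
    by (simp add: pvar_def mult_single)
  then show ?thesis by (metis dvd_triv_left)
qed

lemma poly_mapping_sum_single:
  "(\<Sum>u\<in>Poly_Mapping.keys p. Poly_Mapping.single u (Poly_Mapping.lookup p u)) = p"
  by (rule poly_mapping_eqI) (auto simp: lookup_sum lookup_single when_def in_keys_iff)

text \<open>The explicit form of the ideal generated by the monomials with exponents in
  \<open>E\<close>, see \<open>genideal_monomials\<close>. Membership is tested monomial by
  monomial, which reduces statements about ideals to statements about sets of exponents.\<close>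

definition exponent_ideal :: "'v set \<Rightarrow> ('v \<Rightarrow>\<^sub>0 nat) set \<Rightarrow> ('v, 'k::field) mpoly set" where
  "exponent_ideal V E = {p. \<forall>u\<in>Poly_Mapping.keys p. Poly_Mapping.keys u \<subseteq> V \<and> (\<exists>e\<in>E. \<exists>w. u = e + w)}"

lemma ideal_exponent_ideal: "ideal (exponent_ideal V E :: ('v, 'k::field) mpoly set) (poly_ring V)"
proof -
  let ?R = "poly_ring V :: ('v, 'k) mpoly ring"
  interpret R: cring ?R by (rule poly_ring_cring)
  have mult: "a * b \<in> exponent_ideal V E"
    if a: "a \<in> exponent_ideal V E" and b: "b \<in> carrier ?R" for a b :: "('v, 'k) mpoly"
    unfolding exponent_ideal_def
  proof (intro CollectI ballI)
    fix u assume "u \<in> Poly_Mapping.keys (a * b)"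
    then obtain s t where st: "u = s + t" "s \<in> Poly_Mapping.keys a" "t \<in> Poly_Mapping.keys b"
      using keys_mult[of a b] by blast
    obtain e w where "e \<in> E" "s = e + w" "Poly_Mapping.keys s \<subseteq> V"
      using a st(2) unfolding exponent_ideal_def by blast
    moreover have "Poly_Mapping.keys t \<subseteq> V" using b st(3) by (simp add: poly_ring_def)
    ultimately show "Poly_Mapping.keys u \<subseteq> V \<and> (\<exists>e\<in>E. \<exists>w. u = e + w)"
      using st(1) by (auto simp: keys_add_nat add.assoc)
  qed
  show ?thesis
  proof (rule idealI)
    show "ring ?R" by unfold_locales
    show "subgroup (exponent_ideal V E) (add_monoid ?R)"
    proof
      show "exponent_ideal V E \<subseteq> carrier (add_monoid ?R)"
        by (auto simp: exponent_ideal_def poly_ring_def)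
      show "x \<otimes>\<^bsub>add_monoid ?R\<^esub> y \<in> exponent_ideal V E"
        if "x \<in> exponent_ideal V E" "y \<in> exponent_ideal V E" for x y
        using that Poly_Mapping.keys_add[of x y] unfolding exponent_ideal_def poly_ring_def by auto
      show "\<one>\<^bsub>add_monoid ?R\<^esub> \<in> exponent_ideal V E"
        by (simp add: exponent_ideal_def poly_ring_def)
      fix x :: "('v, 'k) mpoly" assume x: "x \<in> exponent_ideal V E"
      have "\<ominus>\<^bsub>?R\<^esub> x = - x"
        using x by (intro R.minus_equality) (auto simp: exponent_ideal_def poly_ring_def)
      then show "inv\<^bsub>add_monoid ?R\<^esub> x \<in> exponent_ideal V E"
        using x by (simp add: a_inv_def exponent_ideal_def)
    qed
    fix a x :: "('v, 'k) mpoly" assume a: "a \<in> exponent_ideal V E" and x: "x \<in> carrier ?R"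
    show "a \<otimes>\<^bsub>?R\<^esub> x \<in> exponent_ideal V E" "x \<otimes>\<^bsub>?R\<^esub> a \<in> exponent_ideal V E"
      using mult[OF a x] by (simp_all add: poly_ring_def mult.commute)
  qed
qed

lemma genideal_monomials:
  assumes "\<And>e. e \<in> E \<Longrightarrow> Poly_Mapping.keys e \<subseteq> V"
  shows "Idl\<^bsub>poly_ring V\<^esub> ((\<lambda>e. Poly_Mapping.single e 1) ` E) = (exponent_ideal V E :: ('v, 'k::field) mpoly set)"
proof -
  let ?R = "poly_ring V :: ('v, 'k) mpoly ring"
  let ?G = "(\<lambda>e. Poly_Mapping.single e 1) ` E :: ('v, 'k) mpoly set"
  interpret R: cring ?R by (rule poly_ring_cring)
  have G: "?G \<subseteq> carrier ?R" using assms by (simp add: poly_ring_def image_subset_iff)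
  interpret I: ideal "Idl\<^bsub>?R\<^esub> ?G" ?R by (rule R.genideal_ideal[OF G])
  show ?thesis
  proof
    show "Idl\<^bsub>?R\<^esub> ?G \<subseteq> exponent_ideal V E"
    proof (rule R.genideal_minimal[OF ideal_exponent_ideal])
      show "?G \<subseteq> exponent_ideal V E"
        using assms by (auto simp: exponent_ideal_def image_subset_iff intro!: exI[of _ 0])
    qed
    show "exponent_ideal V E \<subseteq> Idl\<^bsub>?R\<^esub> ?G"
    proof
      fix p :: "('v, 'k) mpoly" assume p: "p \<in> exponent_ideal V E"
      have sum: "(\<Sum>u\<in>U. Poly_Mapping.single u (Poly_Mapping.lookup p u)) \<in> Idl\<^bsub>?R\<^esub> ?G"
        if "finite U" "U \<subseteq> Poly_Mapping.keys p" for U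
        using that
      proof (induction U rule: finite_induct)
        case empty
        then show ?case using I.zero_closed by (simp add: poly_ring_def)
      next
        case (insert u U)
        have "u \<in> Poly_Mapping.keys p" using insert.prems by simp
        then obtain e w where e: "e \<in> E" "u = e + w" "Poly_Mapping.keys u \<subseteq> V"
          using p unfolding exponent_ideal_def by blast
        have "Poly_Mapping.single w (Poly_Mapping.lookup p u) \<in> carrier ?R"
          using e by (simp add: poly_ring_def keys_add_nat)
        moreover have "Poly_Mapping.single e 1 \<in> Idl\<^bsub>?R\<^esub> ?G"
          using R.genideal_self[OF G] e(1) by blast
        ultimately have "Poly_Mapping.single w (Poly_Mapping.lookup p u) \<otimes>\<^bsub>?R\<^esub> Poly_Mapping.single e 1
            \<in> Idl\<^bsub>?R\<^esub> ?G" by (rule I.I_l_closed[rotated])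
        then have "Poly_Mapping.single u (Poly_Mapping.lookup p u) \<in> Idl\<^bsub>?R\<^esub> ?G"
          by (simp add: poly_ring_def mult_single e(2) add.commute)
        from I.a_closed[OF this insert.IH] insert.prems insert.hyps
        show ?case by (simp add: poly_ring_def)
      qed
      from sum[OF finite_keys subset_refl] show "p \<in> Idl\<^bsub>?R\<^esub> ?G"
        by (simp add: poly_mapping_sum_single)
    qed
  qed
qed

lemma rainbow_ideal_eq:
  assumes "T \<subseteq> PiE {1..n} A"
  shows "(rainbow_ideal n A T :: ('a, 'k::field) mpoly set) =
    exponent_ideal (all_vars n A) ((\<lambda>t. \<Sum>i=1..n. Poly_Mapping.single (t i) 1) ` T)"
proof -
  have "(\<lambda>t. \<Prod>i=1..n. pvar (t i)) ` T = (\<lambda>e. Poly_Mapping.single e 1 :: ('a, 'k) mpoly) `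
      (\<lambda>t. \<Sum>i=1..n. Poly_Mapping.single (t i) 1) ` T"
    by (simp add: image_image pvar_def prod_single_one)
  moreover have "Poly_Mapping.keys (\<Sum>i=1..n. Poly_Mapping.single (t i) (1 :: nat)) \<subseteq> all_vars n A" if "t \<in> T" for t
    using keys_sum[of "\<lambda>i. Poly_Mapping.single (t i) 1" "{1..n}"] assms that
    by (fastforce simp: all_vars_def)
  ultimately show ?thesis
    unfolding rainbow_ideal_def by (subst genideal_monomials[symmetric]) auto
qed

lemma keys_sum_single_one:
  "finite I \<Longrightarrow> Poly_Mapping.keys (\<Sum>i\<in>I. Poly_Mapping.single (t i) (1 :: nat)) = t ` I"
  by (induction I rule: finite_induct) (auto simp: keys_add_nat)

text \<open>Two monomials have a non-trivial common divisor iff their supports meet, and it suffices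
  to test the generators of the rainbow ideal. So the monomials of the dual are those whose support
  is a hitting set for the points of \<open>T\<close>.\<close>

lemma rainbow_dual_eq:
  assumes T: "T \<subseteq> PiE {1..n} A"
  shows "(rainbow_dual n A T :: ('a, 'k::field) mpoly set) =
    {p. \<forall>u\<in>Poly_Mapping.keys p. Poly_Mapping.keys u \<subseteq> all_vars n A \<and>
      (\<forall>t\<in>T. \<exists>i\<in>{1..n}. t i \<in> Poly_Mapping.keys u)}"
proof -
  define V where "V = all_vars n A"
  define mon :: "(nat \<Rightarrow> 'a) \<Rightarrow> 'a \<Rightarrow>\<^sub>0 nat" where "mon t = (\<Sum>i=1..n. Poly_Mapping.single (t i) 1)" for t
  define E :: "('a \<Rightarrow>\<^sub>0 nat) set" where "E = {u. Poly_Mapping.keys u \<subseteq> V \<and> (\<forall>t\<in>T. \<exists>i\<in>{1..n}. t i \<in> Poly_Mapping.keys u)}"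
  define I where "I = (rainbow_ideal n A T :: ('a, 'k) mpoly set)"
  define G where "G = {p \<in> monomials V. \<forall>q\<in>I \<inter> monomials V. \<exists>d\<in>monomials V. d \<noteq> 1 \<and> d dvd p \<and> d dvd q}"
  have I: "I = exponent_ideal V (mon ` T)"
    unfolding I_def V_def mon_def using T by (rule rainbow_ideal_eq)
  have keys_mon: "Poly_Mapping.keys (mon t) = t ` {1..n}" for t
    unfolding mon_def by (rule keys_sum_single_one) simp
  have tV: "t i \<in> V" if "t \<in> T" "i \<in> {1..n}" for t i
    using T that unfolding V_def all_vars_def by (meson PiE_mem UN_I subsetD)
  have "G = (\<lambda>e. Poly_Mapping.single e 1) ` E"
  proof (intro subset_antisym subsetI)
    fix p assume p: "p \<in> G"
    then obtain u where u: "p = Poly_Mapping.single u 1" "Poly_Mapping.keys u \<subseteq> V"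
      by (auto simp: G_def monomials_def)
    have "\<exists>i\<in>{1..n}. t i \<in> Poly_Mapping.keys u" if t: "t \<in> T" for t
    proof -
      have keys_t: "Poly_Mapping.keys (mon t) \<subseteq> V" using tV[OF t] by (auto simp: keys_mon)
      have "Poly_Mapping.single (mon t) 1 \<in> I"
        using keys_t t by (auto simp: I exponent_ideal_def intro!: exI[of _ 0])
      moreover have "Poly_Mapping.single (mon t) 1 \<in> (monomials V :: ('a, 'k) mpoly set)"
        using keys_t by (auto simp: monomials_def)
      ultimately obtain d where d: "d \<in> monomials V" "d \<noteq> 1" "d dvd p" "d dvd Poly_Mapping.single (mon t) 1"
        using p unfolding G_def by blast
      obtain w where w: "d = Poly_Mapping.single w 1" using d(1) by (auto simp: monomials_def)
      have "w \<noteq> 0" using d(2) w by auto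
      then obtain a where a: "a \<in> Poly_Mapping.keys w" by (metis all_not_in_conv keys_eq_empty)
      have "a \<in> Poly_Mapping.keys u" "a \<in> Poly_Mapping.keys (mon t)"
        using d(3,4) a unfolding w u(1) by (auto dest!: single_dvd_single simp: keys_add_nat)
      then show ?thesis by (auto simp: keys_mon)
    qed
    then show "p \<in> (\<lambda>e. Poly_Mapping.single e 1) ` E" using u by (auto simp: E_def)
  next
    fix p :: "('a, 'k) mpoly" assume "p \<in> (\<lambda>e. Poly_Mapping.single e 1) ` E"
    then obtain u where u: "u \<in> E" "p = Poly_Mapping.single u 1" by blast
    have "\<exists>d\<in>monomials V. d \<noteq> 1 \<and> d dvd p \<and> d dvd q" if q: "q \<in> I" "q \<in> monomials V" for q
    proof -
      obtain v where v: "q = Poly_Mapping.single v 1" using q(2) by (auto simp: monomials_def)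
      then obtain t w where t: "t \<in> T" "v = mon t + w"
        using q(1) by (auto simp: I exponent_ideal_def)
      then obtain i where i: "i \<in> {1..n}" "t i \<in> Poly_Mapping.keys u" using u(1) by (auto simp: E_def)
      have "t i \<in> Poly_Mapping.keys v" using i(1) t(2) by (simp add: keys_add_nat keys_mon)
      then have "pvar (t i) dvd p" "pvar (t i) dvd q"
        unfolding u(2) v using i(2) by (auto intro: pvar_dvd_single)
      moreover have "pvar (t i) \<in> (monomials V :: ('a, 'k) mpoly set)"
        using tV[OF t(1) i(1)] by (auto simp: monomials_def pvar_def)
      moreover have "pvar (t i) \<noteq> (1 :: ('a, 'k) mpoly)"
      proof
        assume "pvar (t i) = (1 :: ('a, 'k) mpoly)"
        then have "Poly_Mapping.keys (pvar (t i) :: ('a, 'k) mpoly) = Poly_Mapping.keys 1" by simp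
        moreover have "Poly_Mapping.keys (Poly_Mapping.single (t i) (1 :: nat)) \<noteq> Poly_Mapping.keys 0"
          by simp
        ultimately show False by (auto simp: pvar_def)
      qed
      ultimately show ?thesis by blast
    qed
    then show "p \<in> G" using u by (auto simp: G_def E_def monomials_def)
  qed
  then have "(rainbow_dual n A T :: ('a, 'k) mpoly set) = exponent_ideal V E"
    unfolding rainbow_dual_def alexander_dual_def V_def[symmetric] I_def[symmetric] G_def[symmetric]
    using genideal_monomials[of E V] by (simp add: E_def)
  \<comment> \<open>The set \<open>E\<close> is closed under multiples, since enlarging the support
    keeps it a hitting set. Generating an ideal therefore adds no new monomials.\<close>
  also have "\<dots> = {p. \<forall>u\<in>Poly_Mapping.keys p. u \<in> E}"
    unfolding exponent_ideal_def
  proof (intro Collect_cong ball_cong refl)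
    fix u :: "'a \<Rightarrow>\<^sub>0 nat"
    show "Poly_Mapping.keys u \<subseteq> V \<and> (\<exists>e\<in>E. \<exists>w. u = e + w) \<longleftrightarrow> u \<in> E"
    proof
      assume "Poly_Mapping.keys u \<subseteq> V \<and> (\<exists>e\<in>E. \<exists>w. u = e + w)"
      then show "u \<in> E" unfolding E_def by (auto simp: keys_add_nat) blast
    next
      assume "u \<in> E"
      moreover have "u = u + 0" by simp
      ultimately show "Poly_Mapping.keys u \<subseteq> V \<and> (\<exists>e\<in>E. \<exists>w. u = e + w)"
        unfolding E_def by blast
    qed
  qed
  finally show ?thesis by (simp add: E_def V_def)
qed

lemma cell_ideal_eq:
  "(cell_ideal n R :: (nat, 'k::field) mpoly set) =
    {p. \<forall>u\<in>Poly_Mapping.keys p. Poly_Mapping.keys u \<subseteq> {1..n} \<and>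
      (\<exists>i\<in>{1..n}. card (R i) \<le> Poly_Mapping.lookup u i)}"
proof -
  define E :: "(nat \<Rightarrow>\<^sub>0 nat) set" where "E = (\<lambda>i. Poly_Mapping.single i (card (R i))) ` {1..n}"
  have "{pvar i ^ card (R i) | i. i \<in> {1..n}} = (\<lambda>e. Poly_Mapping.single e 1 :: (nat, 'k) mpoly) ` E"
    by (auto simp: E_def pvar_power)
  moreover have "Poly_Mapping.keys e \<subseteq> {1..n}" if "e \<in> E" for e
    using that by (auto simp: E_def split: if_splits)
  ultimately have "(cell_ideal n R :: (nat, 'k) mpoly set) = exponent_ideal {1..n} E"
    unfolding cell_ideal_def by (simp only: genideal_monomials)
  also have "\<dots> = {p. \<forall>u\<in>Poly_Mapping.keys p. Poly_Mapping.keys u \<subseteq> {1..n} \<and>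
      (\<exists>i\<in>{1..n}. card (R i) \<le> Poly_Mapping.lookup u i)}"
    unfolding exponent_ideal_def
  proof (intro Collect_cong ball_cong refl conj_cong)
    fix u :: "nat \<Rightarrow>\<^sub>0 nat"
    have "(\<exists>w. u = Poly_Mapping.single i c + w) \<longleftrightarrow> c \<le> Poly_Mapping.lookup u i" for i c
    proof
      assume "c \<le> Poly_Mapping.lookup u i"
      then have "u = Poly_Mapping.single i c + (u - Poly_Mapping.single i c)"
        by (intro poly_mapping_eqI) (auto simp: lookup_add lookup_minus lookup_single when_def)
      then show "\<exists>w. u = Poly_Mapping.single i c + w" by blast
    qed (auto simp: lookup_add)
    then show "(\<exists>e\<in>E. \<exists>w. u = e + w) \<longleftrightarrow> (\<exists>i\<in>{1..n}. card (R i) \<le> Poly_Mapping.lookup u i)"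
      by (simp add: E_def)
  qed
  finally show ?thesis .
qed

section \<open>The collapse map on exponents\<close>

definition collapse_exponent :: "nat \<Rightarrow> (nat \<Rightarrow> 'a set) \<Rightarrow> ('a \<Rightarrow>\<^sub>0 nat) \<Rightarrow> nat \<Rightarrow>\<^sub>0 nat" where
  "collapse_exponent n A u =
    (\<Sum>a\<in>Poly_Mapping.keys u. Poly_Mapping.single (colour n A a) (Poly_Mapping.lookup u a))"

lemma collapse_eq:
  "collapse n A p = (\<Sum>u\<in>Poly_Mapping.keys p.
    Poly_Mapping.single (collapse_exponent n A u) (Poly_Mapping.lookup p u))"
  unfolding collapse_def poly_smult_def pvar_power prod_single_one collapse_exponent_def
  by (simp add: mult_single)

lemma collapse_image:
  "collapse n A ` {p :: ('a, 'k::field) mpoly. \<forall>u\<in>Poly_Mapping.keys p. u \<in> E} =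
    {q. \<forall>w\<in>Poly_Mapping.keys q. w \<in> collapse_exponent n A ` E}"
proof (intro subset_antisym subsetI)
  fix q :: "(nat, 'k) mpoly"
  assume "q \<in> collapse n A ` {p :: ('a, 'k) mpoly. \<forall>u\<in>Poly_Mapping.keys p. u \<in> E}"
  then obtain p :: "('a, 'k) mpoly" where p: "q = collapse n A p" "\<forall>u\<in>Poly_Mapping.keys p. u \<in> E" by blast
  have "Poly_Mapping.keys q \<subseteq> (\<Union>u\<in>Poly_Mapping.keys p.
      Poly_Mapping.keys (Poly_Mapping.single (collapse_exponent n A u) (Poly_Mapping.lookup p u)))"
    unfolding p(1) collapse_eq by (rule keys_sum)
  then show "q \<in> {q. \<forall>w\<in>Poly_Mapping.keys q. w \<in> collapse_exponent n A ` E}"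
    using p(2) by (fastforce split: if_splits)
next
  fix q :: "(nat, 'k) mpoly" assume q: "q \<in> {q. \<forall>w\<in>Poly_Mapping.keys q. w \<in> collapse_exponent n A ` E}"
  \<comment> \<open>One preimage is chosen for each exponent of \<open>q\<close>. The choice
    \<open>g\<close> is injective because collapsing inverts it, so the lifted terms neither merge
    nor cancel.\<close>
  then obtain g where g: "\<And>w. w \<in> Poly_Mapping.keys q \<Longrightarrow> g w \<in> E \<and> collapse_exponent n A (g w) = w"
    by (simp add: image_iff) metis
  have g_inj: "inj_on g (Poly_Mapping.keys q)" by (rule inj_onI) (metis g)
  define p where "p = (\<Sum>w\<in>Poly_Mapping.keys q. Poly_Mapping.single (g w) (Poly_Mapping.lookup q w))"
  have lookup_p: "Poly_Mapping.lookup p (g w) = Poly_Mapping.lookup q w" if "w \<in> Poly_Mapping.keys q" for w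
  proof -
    have "Poly_Mapping.lookup p (g w) =
        (\<Sum>w'\<in>Poly_Mapping.keys q. if w' = w then Poly_Mapping.lookup q w' else 0)"
      unfolding p_def lookup_sum using that g_inj
      by (intro sum.cong) (auto simp: lookup_single when_def dest: inj_onD)
    then show ?thesis using that by simp
  qed
  have "Poly_Mapping.keys p \<subseteq> g ` Poly_Mapping.keys q"
    unfolding p_def using keys_sum[of "\<lambda>w. Poly_Mapping.single (g w) (Poly_Mapping.lookup q w)"]
    by (fastforce split: if_splits)
  moreover have "g ` Poly_Mapping.keys q \<subseteq> Poly_Mapping.keys p"
    using lookup_p by (auto simp: in_keys_iff)
  ultimately have keys_p: "Poly_Mapping.keys p = g ` Poly_Mapping.keys q" by blast
  have "collapse n A p = (\<Sum>w\<in>Poly_Mapping.keys q.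
      Poly_Mapping.single (collapse_exponent n A (g w)) (Poly_Mapping.lookup p (g w)))"
    unfolding collapse_eq keys_p by (simp add: sum.reindex[OF g_inj])
  also have "\<dots> = (\<Sum>w\<in>Poly_Mapping.keys q. Poly_Mapping.single w (Poly_Mapping.lookup q w))"
    using g lookup_p by (intro sum.cong) auto
  also have "\<dots> = q" by (rule poly_mapping_sum_single)
  finally have "q = collapse n A p" ..
  moreover have "\<forall>u\<in>Poly_Mapping.keys p. u \<in> E" unfolding keys_p using g by simp
  ultimately show "q \<in> collapse n A ` {p :: ('a, 'k) mpoly. \<forall>u\<in>Poly_Mapping.keys p. u \<in> E}"
    by (intro image_eqI[of q _ p]) simp_all
qed

lemma colour_eq:
  assumes "disjoint_family_on A {1..n}" "i \<in> {1..n}" "a \<in> A i"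
  shows "colour n A a = i"
  unfolding colour_def
proof (rule the_equality)
  show "i \<in> {1..n} \<and> a \<in> A i" using assms by blast
  show "j = i" if "j \<in> {1..n} \<and> a \<in> A j" for j
    using assms that unfolding disjoint_family_on_def by blast
qed

lemma
  assumes disj: "disjoint_family_on A {1..n}" and fin: "\<And>i. i \<in> {1..n} \<Longrightarrow> finite (A i)"
    and u: "Poly_Mapping.keys u \<subseteq> all_vars n A"
  shows keys_collapse_exponent: "Poly_Mapping.keys (collapse_exponent n A u) \<subseteq> {1..n}"
    and lookup_collapse_exponent: "i \<in> {1..n} \<Longrightarrow>
      Poly_Mapping.lookup (collapse_exponent n A u) i = (\<Sum>a\<in>A i. Poly_Mapping.lookup u a)"
proof -
  have col: "\<exists>i\<in>{1..n}. a \<in> A i \<and> colour n A a = i" if "a \<in> Poly_Mapping.keys u" for a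
    using u that colour_eq[OF disj] by (auto simp: all_vars_def)
  show "Poly_Mapping.keys (collapse_exponent n A u) \<subseteq> {1..n}"
    using keys_sum[of "\<lambda>a. Poly_Mapping.single (colour n A a) (Poly_Mapping.lookup u a)" "Poly_Mapping.keys u"] col
    unfolding collapse_exponent_def by (fastforce split: if_splits)
  assume i: "i \<in> {1..n}"
  have "Poly_Mapping.lookup (collapse_exponent n A u) i =
      (\<Sum>a\<in>Poly_Mapping.keys u. if a \<in> A i then Poly_Mapping.lookup u a else 0)"
    unfolding collapse_exponent_def lookup_sum
  proof (rule sum.cong)
    fix a assume "a \<in> Poly_Mapping.keys u"
    then show "Poly_Mapping.lookup (Poly_Mapping.single (colour n A a) (Poly_Mapping.lookup u a)) i =
        (if a \<in> A i then Poly_Mapping.lookup u a else 0)"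
      using col[of a] colour_eq[OF disj i, of a] by (auto simp: lookup_single when_def)
  qed simp
  also have "\<dots> = (\<Sum>a\<in>Poly_Mapping.keys u \<inter> A i. Poly_Mapping.lookup u a)"
    by (rule sum.inter_restrict[symmetric]) simp
  also have "\<dots> = (\<Sum>a\<in>A i. Poly_Mapping.lookup u a)"
    using fin[OF i] by (intro sum.mono_neutral_left) (auto simp: in_keys_iff)
  finally show "Poly_Mapping.lookup (collapse_exponent n A u) i = (\<Sum>a\<in>A i. Poly_Mapping.lookup u a)" .
qed

section \<open>Maximal cells and the ideal of the polarization\<close>

lemma cells_nonempty:
  "R \<in> cells n A T \<Longrightarrow> i \<in> {1..n} \<Longrightarrow> R i \<noteq> {} \<and> R i \<subseteq> A i"
  by (auto simp: cells_def PiE_iff)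

lemma maximal_cell_above:
  assumes fin: "\<And>i. i \<in> {1..n} \<Longrightarrow> finite (A i)" and R: "R \<in> cells n A T"
  shows "\<exists>S\<in>maximal_cells n A T. \<forall>i\<in>{1..n}. R i \<subseteq> S i"
proof -
  \<comment> \<open>Cells are extensional, so factorwise inclusion on the index set is the pointwise
    order of functions, and a finite set has maximal elements for it.\<close>
  have le_iff: "S \<le> S' \<longleftrightarrow> (\<forall>i\<in>{1..n}. S i \<subseteq> S' i)" if "S \<in> cells n A T" "S' \<in> cells n A T" for S S'
  proof
    assume sub: "\<forall>i\<in>{1..n}. S i \<subseteq> S' i"
    show "S \<le> S'"
    proof (rule le_funI)
      fix i
      have "S i = S' i" if "i \<notin> {1..n}"
        using \<open>S \<in> _\<close> \<open>S' \<in> _\<close> that by (simp add: cells_def PiE_iff extensional_def)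
      then show "S i \<le> S' i" using sub by blast
    qed
  qed (simp add: le_fun_def)
  obtain S where S: "S \<in> cells n A T" "R \<le> S" "\<And>S'. S' \<in> cells n A T \<Longrightarrow> S \<le> S' \<Longrightarrow> S = S'"
    using finite_has_maximal2[OF finite_cells[OF fin] R] by blast
  have "S \<in> maximal_cells n A T"
    unfolding maximal_cells_def using S(1,3) le_iff[OF S(1)] by auto
  then show ?thesis using S(2) le_iff[OF R S(1)] by blast
qed

text \<open>Every point of \<open>T\<close> is a vertex of the complex and so lies in a maximal
  cell. This is what the first part of the theorem rests on.\<close>

lemma Union_maximal_cells:
  assumes fin: "\<And>i. i \<in> {1..n} \<Longrightarrow> finite (A i)" and T: "T \<subseteq> PiE {1..n} A"
  shows "(\<Union>R\<in>maximal_cells n A T. PiE {1..n} R) = T"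
proof
  show "(\<Union>R\<in>maximal_cells n A T. PiE {1..n} R) \<subseteq> T"
    by (auto simp: maximal_cells_def cells_def)
  show "T \<subseteq> (\<Union>R\<in>maximal_cells n A T. PiE {1..n} R)"
  proof
    fix t assume t: "t \<in> T"
    then have tA: "t \<in> PiE {1..n} A" using T by blast
    define S where "S = (\<lambda>i\<in>{1..n}. {t i})"
    have "PiE {1..n} S = {restrict t {1..n}}" unfolding PiE_eq_singleton by (simp add: S_def)
    then have S: "PiE {1..n} S = {t}" using tA by simp
    moreover have "S i \<in> Pow (A i) - {{}}" if "i \<in> {1..n}" for i
      using PiE_mem[OF tA that] that by (simp add: S_def)
    ultimately have "S \<in> cells n A T" using t by (simp add: cells_def S_def PiE_iff)
    then obtain R where R: "R \<in> maximal_cells n A T" "\<forall>i\<in>{1..n}. S i \<subseteq> R i"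
      using maximal_cell_above[where A = A and n = n] fin by blast
    then have "PiE {1..n} S \<subseteq> PiE {1..n} R" by (intro PiE_mono) blast
    then show "t \<in> (\<Union>R\<in>maximal_cells n A T. PiE {1..n} R)" using R(1) S by blast
  qed
qed

text \<open>Shrinking the factors of \<open>Q\<close> to the sizes of \<open>R\<close> gives a cell
  \<open>Q'\<close>. It equals \<open>R\<close> by uniqueness of the maximal cell of its sizes, so
  \<open>R\<close> lies inside \<open>Q\<close>.\<close>

lemma maximal_cell_sizes_incomparable:
  assumes exch: "exchange {1..n} A T" and fin: "\<And>i. i \<in> {1..n} \<Longrightarrow> finite (A i)"
    and R: "R \<in> maximal_cells n A T" and Q: "Q \<in> maximal_cells n A T"
    and le: "\<And>i. i \<in> {1..n} \<Longrightarrow> card (R i) \<le> card (Q i)"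
  shows "Q = R"
proof -
  have Rc: "R \<in> cells n A T" and Qc: "Q \<in> cells n A T"
    and max: "\<And>S. S \<in> cells n A T \<Longrightarrow> \<forall>i\<in>{1..n}. R i \<subseteq> S i \<Longrightarrow> S = R"
    using R Q by (auto simp: maximal_cells_def)
  have sub: "PiE {1..n} R \<subseteq> T" "PiE {1..n} Q \<subseteq> T" using Rc Qc by (auto simp: cells_def)
  have "\<forall>i\<in>{1..n}. \<exists>X\<subseteq>Q i. card X = card (R i)"
    using le by (meson obtain_subset_with_card_n)
  then obtain Q' where Q': "\<And>i. i \<in> {1..n} \<Longrightarrow> Q' i \<subseteq> Q i \<and> card (Q' i) = card (R i)"
    by metis
  have "Q' i = R i" if i: "i \<in> {1..n}" for i
  proof (rule maximal_cell_unique_of_size[where E = "{1..n}", OF exch _ fin sub(1) cells_nonempty[OF Rc]])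
    have "PiE {1..n} Q' \<subseteq> PiE {1..n} Q" using Q' by (intro PiE_mono) blast
    then show "PiE {1..n} Q' \<subseteq> T" using sub(2) by blast
    show "Q' j \<subseteq> A j" if "j \<in> {1..n}" for j using Q'[OF that] cells_nonempty[OF Qc that] by blast
    show "\<not> PiE {1..n} (R(j := insert a (R j))) \<subseteq> T" if j: "j \<in> {1..n}" and a: "a \<in> A j - R j" for j a
    proof
      assume "PiE {1..n} (R(j := insert a (R j))) \<subseteq> T"
      moreover have "(R(j := insert a (R j))) l \<in> Pow (A l) - {{}}" if "l \<in> {1..n}" for l
        using cells_nonempty[OF Rc that] a by auto
      moreover have "R(j := insert a (R j)) \<in> extensional {1..n}"
        using Rc j by (auto simp: cells_def PiE_iff extensional_def)
      ultimately have "R(j := insert a (R j)) \<in> cells n A T" by (simp add: cells_def PiE_iff)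
      then have "R(j := insert a (R j)) = R" by (rule max) auto
      then show False using a by (metis DiffD2 fun_upd_same insertI1)
    qed
  qed (use Q' i in auto)
  then have "\<forall>i\<in>{1..n}. R i \<subseteq> Q i" using Q' by blast
  then show ?thesis by (rule max[OF Qc])
qed

text \<open>The combinatorial form of the decomposition: collapsing remembers only how much degree a
  hitting set uses in each colour, and the maximal cells bound this from below.\<close>

lemma collapse_exponent_image:
  assumes exch: "exchange {1..n} A T" and A: "\<And>i. i \<in> {1..n} \<Longrightarrow> finite (A i) \<and> A i \<noteq> {}"
    and disj: "disjoint_family_on A {1..n}" and T: "T \<subseteq> PiE {1..n} A"
  shows "collapse_exponent n A ` {u. Poly_Mapping.keys u \<subseteq> all_vars n A \<and>
      (\<forall>t\<in>T. \<exists>i\<in>{1..n}. t i \<in> Poly_Mapping.keys u)} =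
    {w. Poly_Mapping.keys w \<subseteq> {1..n} \<and>
      (\<forall>R\<in>maximal_cells n A T. \<exists>i\<in>{1..n}. card (R i) \<le> Poly_Mapping.lookup w i)}"
    (is "_ ` ?E = ?W")
proof (intro subset_antisym subsetI)
  have fin: "\<And>i. i \<in> {1..n} \<Longrightarrow> finite (A i)" using A by blast
  {
    fix w assume "w \<in> collapse_exponent n A ` ?E"
    then obtain u where w: "w = collapse_exponent n A u" and uV: "Poly_Mapping.keys u \<subseteq> all_vars n A"
      and hit: "\<And>t. t \<in> T \<Longrightarrow> \<exists>i\<in>{1..n}. t i \<in> Poly_Mapping.keys u" by blast
    have "\<exists>i\<in>{1..n}. card (R i) \<le> Poly_Mapping.lookup w i" if R: "R \<in> maximal_cells n A T" for R
    proof -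
      have Rc: "R \<in> cells n A T" using R by (simp add: maximal_cells_def)
      \<comment> \<open>If the support contained no whole factor of the cell, one point outside it
        in each factor would give a point of \<open>T\<close> that is not hit.\<close>
      have "\<exists>i\<in>{1..n}. R i \<subseteq> Poly_Mapping.keys u"
      proof (rule ccontr)
        assume "\<not> ?thesis"
        then have "\<forall>i\<in>{1..n}. \<exists>a. a \<in> R i - Poly_Mapping.keys u" by blast
        then obtain s where s: "\<And>i. i \<in> {1..n} \<Longrightarrow> s i \<in> R i - Poly_Mapping.keys u" by metis
        then have "restrict s {1..n} \<in> PiE {1..n} R" by (auto simp: PiE_iff)
        moreover have "PiE {1..n} R \<subseteq> T" using Rc by (simp add: cells_def)
        ultimately have "restrict s {1..n} \<in> T" by blast
        then show False using hit s by fastforce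
      qed
      then obtain i where i: "i \<in> {1..n}" "R i \<subseteq> Poly_Mapping.keys u" by blast
      have RA: "R i \<subseteq> A i" using cells_nonempty[OF Rc i(1)] by blast
      have "card (R i) = (\<Sum>a\<in>R i. 1)" by simp
      also have "\<dots> \<le> (\<Sum>a\<in>R i. Poly_Mapping.lookup u a)"
        using i(2) by (intro sum_mono) (auto simp: in_keys_iff Suc_le_eq)
      also have "\<dots> \<le> (\<Sum>a\<in>A i. Poly_Mapping.lookup u a)"
        using RA fin[OF i(1)] by (intro sum_mono2) auto
      also have "\<dots> = Poly_Mapping.lookup w i"
        unfolding w using lookup_collapse_exponent[OF disj fin uV i(1)] by simp
      finally show ?thesis using i(1) by blast
    qed
    then show "w \<in> ?W" using keys_collapse_exponent[OF disj fin uV] w by blast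
  }
  fix w assume w: "w \<in> ?W"
  \<comment> \<open>Otherwise \<open>cell_of_size\<close> gives a cell whose \<open>i\<close>-th
    factor has one vertex more than the exponent of \<open>w\<close> at \<open>i\<close>, for every
    \<open>i\<close>; a maximal cell above it violates the condition on \<open>w\<close>.\<close>
  have "\<exists>F. (\<forall>i\<in>{1..n}. finite (F i) \<and> card (F i) \<le> Poly_Mapping.lookup w i) \<and>
      (\<forall>t\<in>T. \<exists>i\<in>{1..n}. t i \<in> F i)"
  proof (rule ccontr)
    assume no: "\<not> ?thesis"
    have "\<exists>R. (\<forall>i\<in>{1..n}. R i \<subseteq> A i \<and> card (R i) = Suc (Poly_Mapping.lookup w i)) \<and> PiE {1..n} R \<subseteq> T"
    proof (rule cell_of_size[OF exch finite_atLeastAtMost fin])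
      fix F :: "nat \<Rightarrow> 'a set"
      assume "\<And>i. i \<in> {1..n} \<Longrightarrow> finite (F i) \<and> card (F i) \<le> Poly_Mapping.lookup w i"
      then have "\<not> (\<forall>t\<in>T. \<exists>i\<in>{1..n}. t i \<in> F i)" using no by blast
      then show "\<exists>t\<in>T \<inter> PiE {1..n} A. \<forall>i\<in>{1..n}. t i \<notin> F i" using T by blast
    qed
    then obtain R where R: "\<And>i. i \<in> {1..n} \<Longrightarrow> R i \<subseteq> A i \<and> card (R i) = Suc (Poly_Mapping.lookup w i)"
      "PiE {1..n} R \<subseteq> T" by blast
    have "R i \<noteq> {}" if "i \<in> {1..n}" for i using R(1)[OF that] by force
    moreover have "PiE {1..n} (restrict R {1..n}) = PiE {1..n} R" by (intro PiE_cong) simp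
    ultimately have "restrict R {1..n} \<in> cells n A T" using R by (simp add: cells_def PiE_iff)
    then obtain S where S: "S \<in> maximal_cells n A T" "\<forall>i\<in>{1..n}. restrict R {1..n} i \<subseteq> S i"
      using maximal_cell_above[where A = A and n = n] fin by blast
    obtain i where i: "i \<in> {1..n}" "card (S i) \<le> Poly_Mapping.lookup w i" using w S(1) by blast
    have "S i \<subseteq> A i" using S(1) cells_nonempty[of S n A T i] i(1) by (simp add: maximal_cells_def)
    then have "card (R i) \<le> card (S i)"
      using S(2) i(1) fin[OF i(1)] by (intro card_mono) (auto intro: finite_subset)
    then show False using R(1)[OF i(1)] i(2) by simp
  qed
  then obtain F where F: "\<And>i. i \<in> {1..n} \<Longrightarrow> finite (F i) \<and> card (F i) \<le> Poly_Mapping.lookup w i"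
    and hit: "\<And>t. t \<in> T \<Longrightarrow> \<exists>i\<in>{1..n}. t i \<in> F i" by blast
  have "\<forall>i\<in>{1..n}. \<exists>a. a \<in> A i" using A by blast
  then obtain a0 where a0: "\<And>i. i \<in> {1..n} \<Longrightarrow> a0 i \<in> A i" by metis
  \<comment> \<open>The hitting set may use less degree than \<open>w\<close> prescribes. The rest
    is placed on an arbitrary variable \<open>a0 i\<close> of colour \<open>i\<close>, which is
    harmless because only the support of \<open>u\<close> has to hit \<open>T\<close>.\<close>
  define surplus where "surplus i = Poly_Mapping.lookup w i - card (A i \<inter> F i)" for i
  define f where "f a = (if a \<in> all_vars n A then let i = colour n A a in
      of_bool (a \<in> F i) + (if a = a0 i then surplus i else 0) else 0)" for a
  define u where "u = Abs_poly_mapping f"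
  have f: "f a = of_bool (a \<in> F i) + (if a = a0 i then surplus i else 0)" if "i \<in> {1..n}" "a \<in> A i" for a i
    using that colour_eq[OF disj that] by (auto simp: f_def all_vars_def)
  have "finite (all_vars n A)" using fin by (simp add: all_vars_def)
  then have "finite {a. f a \<noteq> 0}" by (rule finite_subset[rotated]) (auto simp: f_def)
  then have u: "Poly_Mapping.lookup u = f" by (simp add: u_def)
  have uV: "Poly_Mapping.keys u \<subseteq> all_vars n A" by (auto simp: in_keys_iff u f_def split: if_splits)
  have "\<exists>i\<in>{1..n}. t i \<in> Poly_Mapping.keys u" if t: "t \<in> T" for t
  proof -
    obtain i where i: "i \<in> {1..n}" "t i \<in> F i" using hit[OF t] by blast
    then have "t i \<in> A i" using t T by blast
    then have "t i \<in> Poly_Mapping.keys u" using i f[of i "t i"] by (simp add: in_keys_iff u)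
    then show ?thesis using i(1) by blast
  qed
  then have uE: "u \<in> ?E" using uV by blast
  have "w = collapse_exponent n A u"
  proof (rule poly_mapping_eqI)
    fix i
    show "Poly_Mapping.lookup w i = Poly_Mapping.lookup (collapse_exponent n A u) i"
    proof (cases "i \<in> {1..n}")
      case True
      have "(\<Sum>a\<in>A i. f a) = (\<Sum>a\<in>A i. of_bool (a \<in> F i) + (if a = a0 i then surplus i else 0))"
        using f[OF True] by (intro sum.cong) auto
      also have "\<dots> = card (A i \<inter> F i) + surplus i"
        using fin[OF True] a0[OF True] by (simp add: sum.distrib of_bool_def sum.If_cases Int_def)
      also have "\<dots> = Poly_Mapping.lookup w i"
        using F[OF True] card_mono[of "F i" "A i \<inter> F i"] by (simp add: surplus_def)
      finally show ?thesis using lookup_collapse_exponent[OF disj fin uV True] by (simp add: u)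
    next
      case False
      have "Poly_Mapping.keys w \<subseteq> {1..n}" using w by blast
      moreover have "Poly_Mapping.keys (collapse_exponent n A u) \<subseteq> {1..n}"
        by (rule keys_collapse_exponent[OF disj fin uV])
      ultimately have "i \<notin> Poly_Mapping.keys w" "i \<notin> Poly_Mapping.keys (collapse_exponent n A u)"
        using False by blast+
      then show ?thesis by (simp add: in_keys_iff)
    qed
  qed
  then show "w \<in> collapse_exponent n A ` ?E" using uE by (rule image_eqI)
qed

section \<open>The decomposition and its irredundance\<close>

theorem theorem6p7:
  fixes n m :: nat
    and A :: "nat \<Rightarrow> 'a set"
    and T :: "(nat \<Rightarrow> 'a) set"
    and \<jj> :: "(nat, 'k::field) mpoly set"
    and R :: "nat \<Rightarrow> nat \<Rightarrow> 'a set"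
  assumes "\<And>i. i \<in> {1..n} \<Longrightarrow> finite (A i) \<and> A i \<noteq> {}"
    and "disjoint_family_on A {1..n}"
    and "T \<subseteq> PiE {1..n} A"
    and "acyclic_subset TYPE('k) n A T"
    and "artin_monomial_ideal {1..n} \<jj>"
    and "is_polarization n A (rainbow_dual n A T) \<jj>"
    and "bij_betw R {1..m} (maximal_cells n A T)"
  shows "(rainbow_dual n A T :: ('a, 'k) mpoly set) =
      carrier (poly_ring (all_vars n A)) \<inter> (\<Inter>k\<in>{1..m}. rainbow_dual n A (PiE {1..n} (R k)))
    \<and> minimal_irreducible_decomposition {1..n} \<jj> ((\<lambda>k. cell_ideal n (R k)) ` {1..m})
    \<and> bij_betw (cell_ideal n) (maximal_cells n A T)
      ((\<lambda>k. cell_ideal n (R k) :: (nat, 'k) mpoly set) ` {1..m})"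
proof -
  let ?M = "maximal_cells n A T" and ?V = "all_vars n A"
  let ?J = "rainbow_dual n A T :: ('a, 'k) mpoly set"
  let ?c = "cell_ideal n :: (nat \<Rightarrow> 'a set) \<Rightarrow> (nat, 'k) mpoly set"
  have fin: "\<And>i. i \<in> {1..n} \<Longrightarrow> finite (A i)" using assms(1) by blast
  have exch: "exchange {1..n} A T" using fin assms(4) by (rule acyclic_subset_exchange)
  have finM: "finite ?M"
    using finite_cells[of n A T] fin by (simp add: maximal_cells_def)
  have RM: "R ` {1..m} = ?M" using assms(7) by (simp add: bij_betw_def)
  have MA: "PiE {1..n} S \<subseteq> PiE {1..n} A" if "S \<in> ?M" for S
    using that cells_nonempty[of S n A T] by (intro PiE_mono) (auto simp: maximal_cells_def)
  have M_ne: "S i \<noteq> {} \<and> S i \<subseteq> A i" if "S \<in> ?M" "i \<in> {1..n}" for S i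
    using that cells_nonempty[of S n A T i] by (simp add: maximal_cells_def)

  have "carrier (poly_ring ?V) \<inter> (\<Inter>k\<in>{1..m}. rainbow_dual n A (PiE {1..n} (R k))) =
      carrier (poly_ring ?V) \<inter> (\<Inter>S\<in>?M. rainbow_dual n A (PiE {1..n} S) :: ('a, 'k) mpoly set)"
    unfolding RM[symmetric] by simp
  also have "\<dots> = ?J"
  proof -
    \<comment> \<open>A support hits all points of \<open>T\<close> iff it hits all points of each
      maximal cell, since these cells cover \<open>T\<close>.\<close>
    have "(\<forall>t\<in>T. P t) \<longleftrightarrow> (\<forall>S\<in>?M. \<forall>t\<in>PiE {1..n} S. P t)" for P
      using Union_maximal_cells[OF fin assms(3)] by blast
    then show ?thesis
      using rainbow_dual_eq[OF assms(3), where ?'k = 'k] rainbow_dual_eq[OF MA, where ?'k = 'k]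
      by (auto simp: poly_ring_def)
  qed
  finally have a: "?J = carrier (poly_ring ?V) \<inter> (\<Inter>k\<in>{1..m}. rainbow_dual n A (PiE {1..n} (R k)))" ..

  have "\<jj> = collapse n A ` ?J" using assms(6) by (simp add: is_polarization_def)
  also have "\<dots> = {q. \<forall>w\<in>Poly_Mapping.keys q. Poly_Mapping.keys w \<subseteq> {1..n} \<and>
      (\<forall>S\<in>?M. \<exists>i\<in>{1..n}. card (S i) \<le> Poly_Mapping.lookup w i)}"
    using collapse_image[of n A "{u. Poly_Mapping.keys u \<subseteq> ?V \<and>
        (\<forall>t\<in>T. \<exists>i\<in>{1..n}. t i \<in> Poly_Mapping.keys u)}", where ?'k = 'k]
      collapse_exponent_image[OF exch assms(1-3)]
    by (simp add: rainbow_dual_eq[OF assms(3)])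
  also have "\<dots> = carrier (poly_ring {1..n}) \<inter> \<Inter>(?c ` ?M)"
    by (auto simp: cell_ideal_eq poly_ring_def)
  finally have j: "\<jj> = carrier (poly_ring {1..n}) \<inter> \<Inter>(?c ` ?M)" .

  define wit :: "(nat \<Rightarrow> 'a set) \<Rightarrow> (nat, 'k) mpoly"
    where "wit S = Poly_Mapping.single (\<Sum>i=1..n. Poly_Mapping.single i (card (S i) - 1)) 1" for S
  have lookup_wit: "Poly_Mapping.lookup (\<Sum>i=1..n. Poly_Mapping.single i (card (S i) - 1)) i = card (S i) - 1"
    if "i \<in> {1..n}" for S i
    using that by (simp add: lookup_sum lookup_single when_def)
  have keys_wit: "Poly_Mapping.keys (\<Sum>i=1..n. Poly_Mapping.single i (card (S i) - 1)) \<subseteq> {1..n}" for S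
    using keys_sum[of "\<lambda>i. Poly_Mapping.single i (card (S i) - 1)" "{1..n}"] by (fastforce split: if_splits)
  have wit_iff: "wit S \<in> ?c S' \<longleftrightarrow> (\<exists>i\<in>{1..n}. card (S' i) \<le> card (S i) - 1)" for S S'
    using keys_wit[of S] lookup_wit[of _ S] by (simp add: wit_def cell_ideal_eq)
  have card_pos: "card (S i) > 0" if "S \<in> ?M" "i \<in> {1..n}" for S i
    using M_ne[OF that] fin[OF that(2)] finite_subset by (auto simp: card_gt_0_iff)
  have wit_notin: "wit S \<notin> ?c S" if "S \<in> ?M" for S
    using card_pos[OF that] by (fastforce simp: wit_iff)
  have wit_in: "wit S \<in> ?c S'" if "S \<in> ?M" "S' \<in> ?M" "S' \<noteq> S" for S S'
  proof (rule ccontr)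
    assume "wit S \<notin> ?c S'"
    then have "card (S i) \<le> card (S' i)" if "i \<in> {1..n}" for i
      using that by (force simp: wit_iff)
    then have "S' = S" using exch fin that by (intro maximal_cell_sizes_incomparable)
    then show False using that by blast
  qed
  have inj: "inj_on ?c ?M" using wit_in wit_notin by (metis inj_onI)

  have "minimal_irreducible_decomposition {1..n} \<jj> (?c ` ?M)"
    unfolding minimal_irreducible_decomposition_def
  proof (intro conjI ballI)
    show "finite (?c ` ?M)" using finM by simp
    show "\<jj> = carrier (poly_ring {1..n}) \<inter> \<Inter>(?c ` ?M)" by (rule j)
    fix Q assume "Q \<in> ?c ` ?M"
    then obtain S where S: "S \<in> ?M" "Q = ?c S" by blast
    show "irreducible_monomial_ideal {1..n} Q"
      unfolding irreducible_monomial_ideal_def S(2) cell_ideal_def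
      using card_pos[OF S(1)] by (intro exI[of _ "{1..n}"] exI[of _ "\<lambda>i. card (S i)"]) (auto simp: Suc_le_eq)
    have "wit S \<in> carrier (poly_ring {1..n})" using keys_wit by (simp add: wit_def poly_ring_def)
    then have "wit S \<in> carrier (poly_ring {1..n}) \<inter> \<Inter>(?c ` ?M - {Q})"
      using wit_in[OF S(1)] S(2) by blast
    moreover have "wit S \<notin> \<jj>" using wit_notin S(1) j by blast
    ultimately show "carrier (poly_ring {1..n}) \<inter> \<Inter>(?c ` ?M - {Q}) \<noteq> \<jj>" by blast
  qed
  moreover have "(\<lambda>k. ?c (R k)) ` {1..m} = ?c ` ?M" unfolding RM[symmetric] by (simp add: image_image)
  ultimately show ?thesis using a inj by (simp add: bij_betw_def)
qed

end
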